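(* Let $m\geq 1$ and $k\geq 3$ be integers and let $0<\epsilon<1/125$. Then there exist an integer $N_0=N_0(k,\epsilon)$, depending on $k$ and $\epsilon$, and positive constants $c_1$ and $c_2$ depending only on $k$ and $m$ (in particular not on $\epsilon$), such that for every integer $N\geq N_0$, $$N^{\,m-c_1(\log(1/\epsilon))^{\frac{1}{\ell}-1}}\;\leq\; f_{\epsilon}(N,m,k)\;\leq\; N^{\,m-c_2(\log(1/\epsilon))^{-1}},$$ where $\ell=\lceil \log_2 k \rceil$.
   Context: For a positive integer $N$, $[N]=\{1,2,\ldots,N\}$; $\log$ is the natural logarithm and $\|\cdot\|$ is the Euclidean norm on $\mathbb{R}^m$. Given $\epsilon>0$ and positive integers $m,k$, a set $X=\{x_{\vec v}:\ \vec v\in\{0,1,\ldots,k-1\}^m\}\subseteq [N]^m$ is called an $\epsilon$-approximate cube, or a $C_\epsilon(m,k)$, if there exist $\vec a\in\mathbb{R}^m$ and a real $d>0$ such that $\|x_{\vec v}-(\vec a+d\vec v)\|<\epsilon d$ for all $\vec v\in\{0,1,\ldots,k-1\}^m$. The quantity $f_\epsilon(N,m,k)$ is the maximal size of a subset $A\subseteq [N]^m$ that does not contain any $C_\epsilon(m,k)$. *)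

theory Defs
  imports "HOL-Analysis.Analysis"
begin

text \<open>
  The dimension \<open>m\<close> is quantified inside the theorem, so a vector of length \<open>m\<close> is an extensional
  function on \<open>{1..m}\<close>, and the Euclidean norm on \<open>\<real>\<^sup>m\<close> is \<^term>\<open>\<lambda>y. L2_set y {1..m}\<close>.
\<close>

definition grid :: "nat \<Rightarrow> nat \<Rightarrow> (nat \<Rightarrow> nat) set" where
  "grid N m = {1..m} \<rightarrow>\<^sub>E {1..N}"

definition cube_index :: "nat \<Rightarrow> nat \<Rightarrow> (nat \<Rightarrow> nat) set" where
  "cube_index m k = {1..m} \<rightarrow>\<^sub>E {0..<k}"

definition approx_cube :: "real \<Rightarrow> nat \<Rightarrow> nat \<Rightarrow> nat \<Rightarrow> (nat \<Rightarrow> nat) set \<Rightarrow> bool" where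
  "approx_cube \<epsilon> N m k X \<longleftrightarrow>
     X \<subseteq> grid N m \<and>
     (\<exists>x :: (nat \<Rightarrow> nat) \<Rightarrow> (nat \<Rightarrow> nat).
        X = x ` cube_index m k \<and>
        (\<exists>a \<in> {1..m} \<rightarrow>\<^sub>E (UNIV :: real set). \<exists>d > 0.
           \<forall>v \<in> cube_index m k.
             L2_set (\<lambda>i. real (x v i) - (a i + d * real (v i))) {1..m} < \<epsilon> * d))"

text \<open>
  For \<open>k \<ge> 1\<close> every cube is nonempty, so the empty set is cube-free and the maximum is taken over
  a finite nonempty set.
\<close>

definition max_cube_free :: "real \<Rightarrow> nat \<Rightarrow> nat \<Rightarrow> nat \<Rightarrow> nat" where
  "max_cube_free \<epsilon> N m k =
     Max {card A | A. A \<subseteq> grid N m \<and> \<not> (\<exists>X. X \<subseteq> A \<and> approx_cube \<epsilon> N m k X)}"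

end

theory Submission
  imports Defs
begin

text \<open>
  Write \<open>\<Lambda> = ln (1/\<epsilon>)\<close>. Both bounds come from looking at integers on the scales \<open>b, b\<^sup>2, b\<^sup>3, ...\<close>,
  where \<open>b\<close> is of order \<open>1/\<epsilon>\<close>: if a cube has side about \<open>b\<^sup>i\<close>, the permitted error is about
  \<open>b\<^sup>i\<^sup>-\<^sup>1\<close>, one scale below. There are about \<open>ln N / \<Lambda>\<close> scales, and the theorem says how much
  density is lost at each of them.

  Upper bound. Cut \<open>[N]\<^sup>m\<close> into cells of side \<open>s\<close>, and a cell of side \<open>k h s\<close> into \<open>(k h)\<^sup>m\<close> such
  cells, where \<open>h \<ge> m/\<epsilon>\<close>. One point from each of the \<open>k\<^sup>m\<close> cells \<open>u + h v\<close> would form an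
  approximate cube with side \<open>s h\<close>, so for every \<open>u\<close> some \<open>v\<close> gives an empty cell; at least
  the proportion \<open>k\<^sup>-\<^sup>m\<close> of the cells is empty (\<open>card_cells_step\<close>). Over \<open>t\<close> scales this saves the
  factor \<open>exp (-t/k\<^sup>m)\<close>, which is \<open>N\<close> to a negative power of order \<open>1/\<Lambda>\<close>. Since \<open>N\<^sub>0\<close> must not depend on
  \<open>m\<close>, the number of scales can be too small to absorb the constants; then \<open>ln N\<close> is at most a constant
  times \<open>\<Lambda>\<close>, and the claim only asks for a constant factor, which one family of exact cubes
  gives (\<open>card_le_missing_exact_cubes\<close>).

  Lower bound. Projecting a cube to its first coordinate gives an approximate progression, so
  \<open>m = 1\<close> is enough (\<open>max_cube_free_ge_product\<close>). Take all numbers whose digits, in a base of order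
  \<open>1/\<epsilon>\<close>, lie in a set \<open>S\<close> without \<open>k\<close>-term progressions. In an approximate progression of such
  numbers the second differences are below \<open>4 \<epsilon> d\<close>, so the digits above that size form exact
  progressions and are constant; the terms then differ by less than \<open>d/2\<close>, which is absurd
  (\<open>digit_set_no_approx_progression\<close>). The exponent \<open>1/\<ell> - 1\<close> comes from the density of \<open>S\<close>, due
  to Rankin: if \<open>k > 2\<^sup>q\<close>, there is such an \<open>S\<close> in \<open>[M]\<close> of size
  \<open>M exp (-c (ln M) powr (1/(q+1)))\<close>.

  Rankin's theorem (\<open>rankin_progression_free_sets\<close>) is an induction on \<open>q\<close>, for sequences of degree \<open>D\<close>
  with \<open>2\<^sup>q D < k\<close> in place of arithmetic progressions. If the digits of a sequence have
  degree at most \<open>D\<close>, the sum of their squares has degree at most \<open>2 D\<close>. Restricting that sum to a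
  set free of sequences of degree \<open>2 D\<close>, which the induction supplies, makes it constant, so the digits
  are bounded, and a bounded sequence of finite degree is constant.
\<close>

section \<open>Digits in a large base\<close>

definition digit_sum :: "int \<Rightarrow> nat \<Rightarrow> (nat \<Rightarrow> int) \<Rightarrow> int" where
  "digit_sum B n s = (\<Sum>i<n. s i * B ^ i)"

lemma geometric_sum_int: "(B - 1) * (\<Sum>i<n. B ^ i) = B ^ n - (1::int)"
  by (induction n) (auto simp: algebra_simps)

lemma abs_digit_sum_le:
  assumes "\<And>i. i < n \<Longrightarrow> \<bar>s i\<bar> \<le> Y" "B \<ge> 0"
  shows "\<bar>digit_sum B n s\<bar> \<le> Y * (\<Sum>i<n. B ^ i)"
proof -
  have "\<bar>digit_sum B n s\<bar> \<le> (\<Sum>i<n. \<bar>s i * B ^ i\<bar>)"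
    unfolding digit_sum_def by (rule sum_abs)
  also have "\<dots> \<le> (\<Sum>i<n. Y * B ^ i)"
    using assms by (intro sum_mono) (auto simp: abs_mult intro!: mult_right_mono)
  finally show ?thesis by (simp add: sum_distrib_left)
qed

lemma digit_sum_diff: "digit_sum B n s - digit_sum B n t = digit_sum B n (\<lambda>i. s i - t i)"
  by (simp add: digit_sum_def sum_subtractf left_diff_distrib)

lemma digit_sum_bounds:
  assumes "\<And>i. i < n \<Longrightarrow> 0 \<le> s i \<and> s i < y" "y \<le> B"
  shows "0 \<le> digit_sum B n s" "digit_sum B n s < B ^ n"
proof -
  have "0 \<le> digit_sum B n s \<and> digit_sum B n s < B ^ n"
    using assms(1)
  proof (induction n)
    case 0
    then show ?case by (simp add: digit_sum_def)
  next
    case (Suc n)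
    have B: "0 \<le> B" using Suc.prems[of 0] assms(2) by simp
    have "s n * B ^ n \<le> (B - 1) * B ^ n"
      using Suc.prems[of n] assms(2) B by (intro mult_right_mono) auto
    moreover have "0 \<le> s n * B ^ n" using Suc.prems[of n] B by simp
    moreover have "0 \<le> digit_sum B n s \<and> digit_sum B n s < B ^ n"
      using Suc by simp
    ultimately show ?case by (auto simp: digit_sum_def algebra_simps)
  qed
  then show "0 \<le> digit_sum B n s" "digit_sum B n s < B ^ n" by auto
qed

text \<open>
  The digits may have either sign. Below position \<open>r\<close> the sum is at most \<open>Y (B^r - 1) / (B - 1)\<close> in
  absolute value, which is less than \<open>B^r / 2\<close>, so the leading term cannot be cancelled.
\<close>

lemma top_digit_dominates:
  assumes bd: "\<And>i. i < n \<Longrightarrow> \<bar>c i\<bar> \<le> Y" and B: "2 * Y < B"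
    and r: "r < n" "c r \<noteq> 0" "\<And>i. r < i \<Longrightarrow> i < n \<Longrightarrow> c i = 0"
  shows "B ^ r \<le> 2 * \<bar>digit_sum B n c\<bar>"
proof -
  have Y: "0 \<le> Y" using bd[OF r(1)] by linarith
  define G where "G = (\<Sum>i<r. B ^ i)"
  have G: "0 \<le> G" unfolding G_def using Y B by (intro sum_nonneg) auto
  have low: "\<bar>digit_sum B r c\<bar> \<le> Y * G"
    unfolding G_def using bd r(1) Y B by (intro abs_digit_sum_le) auto
  have "2 * (Y * G) \<le> (B - 1) * G"
    using mult_right_mono[of "2 * Y" "B - 1" G] G B by simp
  also have "\<dots> = B ^ r - 1"
    unfolding G_def by (rule geometric_sum_int)
  finally have low2: "2 * \<bar>digit_sum B r c\<bar> \<le> B ^ r - 1" using low by linarith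
  have "digit_sum B n c = (\<Sum>i<Suc r. c i * B ^ i)"
    unfolding digit_sum_def using r by (intro sum.mono_neutral_right) (auto simp: not_less)
  then have eq: "digit_sum B n c = digit_sum B r c + c r * B ^ r"
    by (simp add: digit_sum_def)
  have "1 * B ^ r \<le> \<bar>c r\<bar> * B ^ r"
    using r(2) Y B by (intro mult_right_mono) auto
  then have "B ^ r \<le> \<bar>c r * B ^ r\<bar>" using Y B by (simp add: abs_mult)
  then show ?thesis using eq low2 by linarith
qed

lemma high_digits_vanish:
  assumes bd: "\<And>i. i < n \<Longrightarrow> \<bar>c i\<bar> \<le> Y" and B: "2 * Y < B"
    and small: "2 * \<bar>digit_sum B n c\<bar> < B ^ p" and i: "p \<le> i" "i < n"
  shows "c i = 0"
proof (rule ccontr)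
  assume ci: "c i \<noteq> 0"
  define R where "R = {r. r < n \<and> c r \<noteq> 0}"
  have fin: "finite R" unfolding R_def by simp
  have iR: "i \<in> R" using ci i by (simp add: R_def)
  define r where "r = Max R"
  have rR: "r \<in> R" unfolding r_def using fin iR by (intro Max_in) auto
  have ir: "i \<le> r" unfolding r_def using fin iR by simp
  have top: "c t = 0" if "r < t" "t < n" for t
    using that fin Max_ge[of R t] unfolding r_def[symmetric] by (auto simp: R_def)
  have "B ^ r \<le> 2 * \<bar>digit_sum B n c\<bar>"
    using bd B rR top by (intro top_digit_dominates[of n c Y]) (auto simp: R_def)
  moreover have "B ^ p \<le> B ^ r"
    using ir i B bd[OF i(2)] by (intro power_increasing) auto
  ultimately show False using small by linarith
qed

lemma inj_on_digit_sum:
  assumes S: "S \<subseteq> {0..<y}" and B: "2 * y \<le> B"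
  shows "inj_on (digit_sum B n) ({..<n} \<rightarrow>\<^sub>E S)"
proof (rule inj_onI)
  fix s t assume s: "s \<in> {..<n} \<rightarrow>\<^sub>E S" and t: "t \<in> {..<n} \<rightarrow>\<^sub>E S"
    and eq: "digit_sum B n s = digit_sum B n t"
  show "s = t"
  proof (rule PiE_ext[OF s t])
    fix i assume i: "i \<in> {..<n}"
    have bd: "\<bar>s j - t j\<bar> \<le> y - 1" if "j < n" for j
    proof -
      have "s j \<in> {0..<y}" "t j \<in> {0..<y}" using s t S that by auto
      then show ?thesis by auto
    qed
    have "s i - t i = 0"
      using eq bd B i
      by (intro high_digits_vanish[of n "\<lambda>i. s i - t i" "y - 1" B 0])
         (auto simp: digit_sum_diff[symmetric])
    then show "s i = t i" by simp
  qed
qed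

section \<open>Integer sequences of bounded degree\<close>

definition fdiff :: "(nat \<Rightarrow> int) \<Rightarrow> nat \<Rightarrow> int" where
  "fdiff x j = x (Suc j) - x j"

text \<open>
  These are the restrictions to the naturals of the integer-valued polynomials of degree at most \<open>D\<close>.
  Differences are used instead of coefficients because they can be read off one digit at a time.
\<close>

definition degree_le :: "nat \<Rightarrow> (nat \<Rightarrow> int) \<Rightarrow> bool" where
  "degree_le D x \<longleftrightarrow> (\<forall>j. (fdiff ^^ Suc D) x j = 0)"

text \<open>
  The \<open>n\<close>-th difference at \<open>j\<close> depends on the values at \<open>j, ..., j + n\<close> only; this is what makes
  statements about the first \<open>k\<close> terms of a sequence possible.
\<close>

lemma fdiff_funpow_cong:
  "(\<And>i. i \<le> j + n \<Longrightarrow> x i = y i) \<Longrightarrow> (fdiff ^^ n) x j = (fdiff ^^ n) y j"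
  by (induction n arbitrary: j) (auto simp: fdiff_def)

lemma abs_fdiff_funpow_le:
  "(\<And>i. i \<le> j + n \<Longrightarrow> \<bar>x i\<bar> \<le> Y) \<Longrightarrow> \<bar>(fdiff ^^ n) x j\<bar> \<le> 2 ^ n * Y"
proof (induction n arbitrary: j)
  case (Suc n)
  have "\<bar>(fdiff ^^ n) x (Suc j)\<bar> \<le> 2 ^ n * Y" "\<bar>(fdiff ^^ n) x j\<bar> \<le> 2 ^ n * Y"
    using Suc.prems by (auto intro!: Suc.IH)
  then show ?case by (simp add: fdiff_def[of "(fdiff ^^ n) x"])
qed auto

lemma fdiff_funpow_digit_sum:
  "(fdiff ^^ r) (\<lambda>j. digit_sum B n (s j)) j = digit_sum B n (\<lambda>i. (fdiff ^^ r) (\<lambda>j. s j i) j)"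
  by (induction r arbitrary: j) (auto simp: fdiff_def digit_sum_diff)

lemma degree_le_0: "degree_le 0 x \<longleftrightarrow> (\<forall>j. x j = x 0)"
proof
  assume *: "degree_le 0 x"
  have "x j = x 0" for j
    by (induction j) (use * in \<open>auto simp: degree_le_def fdiff_def\<close>)
  then show "\<forall>j. x j = x 0" by blast
next
  assume *: "\<forall>j. x j = x 0"
  show "degree_le 0 x" unfolding degree_le_def
    using * by (metis fdiff_def funpow_0 funpow.simps(2) comp_apply diff_self)
qed

lemma degree_le_Suc: "degree_le (Suc D) x \<longleftrightarrow> degree_le D (fdiff x)"
  by (simp only: degree_le_def funpow_Suc_right[of "Suc D"] comp_apply)

lemma degree_le_const: "degree_le D (\<lambda>_. c)"
proof (induction D arbitrary: c)
  case (Suc D)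
  have "fdiff (\<lambda>_. c) = (\<lambda>_. 0)" by (auto simp: fdiff_def)
  then show ?case using Suc[of 0] by (simp add: degree_le_Suc)
qed (simp add: degree_le_0)

lemma degree_le_shift: "degree_le D x \<Longrightarrow> degree_le D (\<lambda>j. x (Suc j))"
proof -
  have "(fdiff ^^ n) (\<lambda>j. x (Suc j)) j = (fdiff ^^ n) x (Suc j)" for n j
    by (induction n arbitrary: j) (auto simp: fdiff_def)
  then show "degree_le D x \<Longrightarrow> degree_le D (\<lambda>j. x (Suc j))" by (simp only: degree_le_def) simp
qed

lemma degree_le_add: "degree_le D x \<Longrightarrow> degree_le D y \<Longrightarrow> degree_le D (\<lambda>j. x j + y j)"
proof -
  have "(fdiff ^^ n) (\<lambda>j. x j + y j) j = (fdiff ^^ n) x j + (fdiff ^^ n) y j" for n j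
    by (induction n arbitrary: j) (auto simp: fdiff_def)
  then show "degree_le D x \<Longrightarrow> degree_le D y \<Longrightarrow> degree_le D (\<lambda>j. x j + y j)"
    by (simp only: degree_le_def) simp
qed

lemma degree_le_cmult: "degree_le D x \<Longrightarrow> degree_le D (\<lambda>j. c * x j)"
proof -
  have "(fdiff ^^ n) (\<lambda>j. c * x j) j = c * (fdiff ^^ n) x j" for n j
    by (induction n arbitrary: j) (auto simp: fdiff_def algebra_simps)
  then show "degree_le D x \<Longrightarrow> degree_le D (\<lambda>j. c * x j)"
    by (simp only: degree_le_def) simp
qed

lemma degree_le_sum:
  "finite I \<Longrightarrow> (\<And>i. i \<in> I \<Longrightarrow> degree_le D (x i)) \<Longrightarrow> degree_le D (\<lambda>j. \<Sum>i\<in>I. x i j)"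
  by (induction I rule: finite_induct) (auto intro: degree_le_const degree_le_add)

text \<open>
  Induction on \<open>a + b\<close>, by the product rule \<open>\<Delta>(x y)(j) = x(j+1) \<Delta>y(j) + \<Delta>x(j) y(j)\<close>.
\<close>

lemma degree_le_mult:
  "degree_le a x \<Longrightarrow> degree_le b y \<Longrightarrow> degree_le (a + b) (\<lambda>j. x j * y j)"
proof (induction "a + b" arbitrary: a b x y)
  case 0
  then show ?case by (simp add: degree_le_0) (metis)
next
  case (Suc n)
  consider "a = 0" | "b = 0" | a' b' where "a = Suc a'" "b = Suc b'"
    by (cases a; cases b) auto
  then show ?case
  proof cases
    case 1
    then have "x j * y j = x 0 * y j" for j
      using Suc.prems(1) by (metis degree_le_0)
    then have "(\<lambda>j. x j * y j) = (\<lambda>j. x 0 * y j)" by blast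
    then show ?thesis using 1 degree_le_cmult[OF Suc.prems(2), of "x 0"] by simp
  next
    case 2
    then have "x j * y j = y 0 * x j" for j
      using Suc.prems(2) by (metis degree_le_0 mult.commute)
    then have "(\<lambda>j. x j * y j) = (\<lambda>j. y 0 * x j)" by blast
    then show ?thesis using 2 degree_le_cmult[OF Suc.prems(1), of "y 0"] by simp
  next
    case 3
    have "degree_le (a + b') (\<lambda>j. x (Suc j) * fdiff y j)"
      using 3 Suc.prems Suc.hyps(2)
      by (intro Suc.hyps(1) degree_le_shift) (auto simp: degree_le_Suc)
    moreover have "degree_le (a' + b) (\<lambda>j. fdiff x j * y j)"
      using 3 Suc.prems Suc.hyps(2)
      by (intro Suc.hyps(1)) (auto simp: degree_le_Suc)
    ultimately have "degree_le (Suc (a' + b')) (\<lambda>j. x (Suc j) * fdiff y j + fdiff x j * y j)"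
      using 3 by (intro degree_le_add) simp_all
    moreover have "(\<lambda>j. x (Suc j) * fdiff y j + fdiff x j * y j) = fdiff (\<lambda>j. x j * y j)"
      by (auto simp: fdiff_def algebra_simps)
    ultimately show ?thesis using 3 by (simp add: degree_le_Suc)
  qed
qed

text \<open>
  The difference sequence is extended by induction and then summed. The extension to all indices is
  what allows boundedness arguments for digit sequences that are given for \<open>j < k\<close> only.
\<close>

lemma degree_le_extension:
  assumes "\<And>j. j + Suc D < k \<Longrightarrow> (fdiff ^^ Suc D) x j = 0"
  shows "\<exists>y. degree_le D y \<and> (\<forall>j<k. y j = x j)"
  using assms
proof (induction D arbitrary: x k)
  case 0
  have "x j = x 0" if "j < k" for j
    using that by (induction j) (use 0 in \<open>auto simp: fdiff_def\<close>)
  then have "degree_le 0 (\<lambda>_. x 0) \<and> (\<forall>j<k. x 0 = x j)"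
    using degree_le_const by metis
  then show ?case by blast
next
  case (Suc D)
  have "(fdiff ^^ Suc D) (fdiff x) j = 0" if "j + Suc D < k - 1" for j
    using Suc.prems[of j] that by (simp only: funpow_Suc_right[of "Suc D"] comp_apply)
  from Suc.IH[OF this] obtain z where z: "degree_le D z" "\<And>j. j < k - 1 \<Longrightarrow> z j = fdiff x j"
    by blast
  define y where "y j = x 0 + (\<Sum>i<j. z i)" for j
  have "fdiff y = z" by (auto simp: fdiff_def y_def)
  moreover have "y j = x j" if "j < k" for j
    using that by (induction j) (auto simp: y_def z(2) fdiff_def)
  ultimately show ?case using z(1) by (intro exI[of _ y]) (auto simp: degree_le_Suc)
qed

lemma degree_le_constant_start:
  assumes "degree_le D x" "\<And>j. j \<le> D \<Longrightarrow> x j = x 0"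
  shows "x j = x 0"
  using assms
proof (induction D arbitrary: x j)
  case 0
  then show ?case by (metis degree_le_0)
next
  case (Suc D)
  have z: "fdiff x i = 0" if "i \<le> D" for i
    using Suc.prems(2)[of i] Suc.prems(2)[of "Suc i"] that by (simp add: fdiff_def)
  have "fdiff x i = 0" for i
    using Suc.IH[of "fdiff x" i] Suc.prems(1) z by (simp add: degree_le_Suc)
  then have "\<And>i. x (Suc i) = x i" by (simp add: fdiff_def)
  then show ?case by (induction j) auto
qed

text \<open>
  The difference sequence is bounded, hence constant by induction, so the sequence is linear, and a
  bounded linear sequence is constant.
\<close>

lemma degree_le_bounded_constant:
  assumes "degree_le D x" "\<And>j. \<bar>x j\<bar> \<le> C"
  shows "x j = x 0"
  using assms
proof (induction D arbitrary: x j C)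
  case 0
  then show ?case by (metis degree_le_0)
next
  case (Suc D)
  have "\<bar>fdiff x i\<bar> \<le> 2 * C" for i
    using Suc.prems(2)[of i] Suc.prems(2)[of "Suc i"] by (simp add: fdiff_def)
  then have "fdiff x i = fdiff x 0" for i
    using Suc.IH[of "fdiff x" "2 * C" i] Suc.prems(1) by (simp add: degree_le_Suc)
  then have step: "x (Suc i) = x i + fdiff x 0" for i
    by (metis add_diff_cancel_left' diff_add_cancel fdiff_def add.commute)
  have lin: "x i = x 0 + int i * fdiff x 0" for i
    by (induction i) (auto simp: step algebra_simps)
  have "fdiff x 0 = 0"
  proof (rule ccontr)
    assume "fdiff x 0 \<noteq> 0"
    then have "int i * 1 \<le> int i * \<bar>fdiff x 0\<bar>" for i by (intro mult_left_mono) auto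
    then have "int i \<le> \<bar>x i - x 0\<bar>" for i by (simp add: lin[of i] abs_mult)
    moreover have "\<bar>x i - x 0\<bar> \<le> 2 * C" for i
      using Suc.prems(2)[of i] Suc.prems(2)[of 0] by linarith
    ultimately have "int i \<le> 2 * C" for i by (meson order_trans)
    from this[of "nat (2 * C + 1)"] show False by linarith
  qed
  then show ?case using lin[of j] by simp
qed

section \<open>Large sets without polynomial progressions\<close>

text \<open>
  For \<open>D = 1\<close> this says that \<open>S\<close> has no nonconstant arithmetic progression of length \<open>k\<close>. The notion
  is useful for \<open>D < k\<close>, when the first \<open>k\<close> terms determine the sequence.
\<close>

definition progression_free :: "nat \<Rightarrow> nat \<Rightarrow> int set \<Rightarrow> bool" where
  "progression_free k D S \<longleftrightarrow>
     (\<forall>x. degree_le D x \<and> (\<forall>j<k. x j \<in> S) \<longrightarrow> (\<forall>j. x j = x 0))"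

text \<open>
  Digits in \<open>{0..<y}\<close> have differences of order \<open>D + 1\<close> below \<open>2^(D+1) y\<close>, half of the base, so taking
  these differences produces no carries. If the difference of the numbers themselves is small, the
  differences of their high digits must therefore vanish. With \<open>p = 0\<close> this applies to exact
  progressions, with larger \<open>p\<close> to approximate ones.
\<close>

lemma high_digit_degree_le:
  fixes s :: "nat \<Rightarrow> nat \<Rightarrow> int" and y D :: nat
  defines "B \<equiv> 2 ^ (D + 2) * int y"
  assumes digits: "\<And>j i. j < k \<Longrightarrow> i < n \<Longrightarrow> 0 \<le> s j i \<and> s j i < int y"
    and small: "\<And>j. j + Suc D < k \<Longrightarrow>
      2 * \<bar>(fdiff ^^ Suc D) (\<lambda>j. digit_sum B n (s j)) j\<bar> < B ^ p"
    and i: "p \<le> i" "i < n"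
  shows "\<exists>z. degree_le D z \<and> (\<forall>j<k. z j = s j i)"
proof (rule degree_le_extension)
  fix j assume j: "j + Suc D < k"
  show "(fdiff ^^ Suc D) (\<lambda>j. s j i) j = 0"
  proof (rule high_digits_vanish[of n _ "2 ^ Suc D * (int y - 1)" B p i])
    fix i' assume "i' < n"
    then have "\<bar>s t i'\<bar> \<le> int y - 1" if "t \<le> j + Suc D" for t
      using digits[of t i'] that j by auto
    then show "\<bar>(fdiff ^^ Suc D) (\<lambda>j. s j i') j\<bar> \<le> 2 ^ Suc D * (int y - 1)"
      by (rule abs_fdiff_funpow_le)
  next
    show "2 * (2 ^ Suc D * (int y - 1)) < B" by (simp add: B_def algebra_simps)
  next
    show "2 * \<bar>digit_sum B n (\<lambda>i. (fdiff ^^ Suc D) (\<lambda>j. s j i) j)\<bar> < B ^ p"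
      using small[OF j] unfolding fdiff_funpow_digit_sum .
  qed (use i in auto)
qed

lemma progression_free_singleton:
  assumes "D < k"
  shows "progression_free k D {c}"
  unfolding progression_free_def
proof (intro allI impI)
  fix x j assume "degree_le D x \<and> (\<forall>j<k. x j \<in> {c})"
  then have "degree_le D x" and "\<And>i. i \<le> D \<Longrightarrow> x i = x 0"
    using assms by (auto simp: less_le_trans)
  then show "x j = x 0" by (rule degree_le_constant_start)
qed

text \<open>
  For a sequence of degree \<open>D\<close>, each digit has degree \<open>D\<close>, so the sum of squares of the digits
  has degree \<open>2 D\<close> and is constant by the assumption on \<open>S'\<close>. Hence the digits, extended to all
  indices, are bounded, and so constant.
\<close>

lemma progression_free_sphere:
  fixes n y :: nat and a :: int
  assumes S': "progression_free k (2 * D) S'" and Dk: "D < k"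
  defines "B \<equiv> 2 ^ (D + 2) * int y"
  defines "E \<equiv> {s \<in> {..<n} \<rightarrow>\<^sub>E {0..<int y}. (\<Sum>i<n. (s i)\<^sup>2) - a \<in> S'}"
  shows "progression_free k D (digit_sum B n ` E)"
  unfolding progression_free_def
proof (intro allI impI)
  fix x j0 assume x: "degree_le D x \<and> (\<forall>j<k. x j \<in> digit_sum B n ` E)"
  then have "\<forall>j\<in>{..<k}. \<exists>s. s \<in> E \<and> x j = digit_sum B n s" by auto
  then obtain s where s: "\<And>j. j < k \<Longrightarrow> s j \<in> E" "\<And>j. j < k \<Longrightarrow> x j = digit_sum B n (s j)"
    by (metis lessThan_iff)
  have sb: "0 \<le> s j i \<and> s j i < int y" if "j < k" "i < n" for j i
    using s(1)[OF that(1)] that(2) by (force simp: E_def)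
  have "\<exists>z. degree_le D z \<and> (\<forall>j<k. z j = s j i)" if i: "i < n" for i
  proof (rule high_digit_degree_le[of k n s y D 0 i])
    fix j assume j: "j + Suc D < k"
    have "(fdiff ^^ Suc D) (\<lambda>j. digit_sum B n (s j)) j = (fdiff ^^ Suc D) x j"
      using j by (intro fdiff_funpow_cong) (simp add: s(2))
    also have "\<dots> = 0" using x by (simp only: degree_le_def)
    finally show "2 * \<bar>(fdiff ^^ Suc D) (\<lambda>j. digit_sum (2 ^ (D + 2) * int y) n (s j)) j\<bar>
        < (2 ^ (D + 2) * int y) ^ 0" by (simp only: B_def) simp
  qed (use sb i in auto)
  then obtain z where z: "\<And>i. i < n \<Longrightarrow> degree_le D (z i)"
    "\<And>i j. i < n \<Longrightarrow> j < k \<Longrightarrow> z i j = s j i" by metis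
  define q where "q j = (\<Sum>i<n. z i j * z i j)" for j
  have "degree_le (2 * D) (\<lambda>j. q j + (- a))" unfolding q_def mult_2
    using z(1) by (intro degree_le_add degree_le_const degree_le_sum degree_le_mult) auto
  moreover have "q j + (- a) \<in> S'" if "j < k" for j
    using s(1)[OF that] that by (simp add: E_def q_def z(2) power2_eq_square)
  ultimately have "\<And>j. q j + (- a) = q 0 + (- a)"
    using S' unfolding progression_free_def by meson
  then have q: "\<And>j. q j = q 0" by simp
  have zc: "z i j = z i 0" if i: "i < n" for i j
  proof (rule degree_le_bounded_constant[OF z(1)[OF i], of "q 0"])
    fix t
    have "\<bar>z i t\<bar> \<le> z i t * z i t"
      by (metis abs_ge_zero abs_mult_self_eq mult_left_mono mult.right_neutral abs_zero
          int_one_le_iff_zero_less less_le mult_zero_left order_refl)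
    also have "\<dots> \<le> q t" unfolding q_def using i by (intro member_le_sum) auto
    finally show "\<bar>z i t\<bar> \<le> q 0" unfolding q[of t] .
  qed
  have xz: "x j = digit_sum B n (\<lambda>i. z i j)" if "j < k" for j
    using s(2)[OF that] z(2) that by (simp add: digit_sum_def)
  have zc0: "digit_sum B n (\<lambda>i. z i j) = digit_sum B n (\<lambda>i. z i 0)" for j
    unfolding digit_sum_def by (intro sum.cong refl) (metis zc lessThan_iff)
  have "x j = x 0" if "j < k" for j
    using xz[OF that] xz[of 0] that zc0[of j] by linarith
  then have "\<And>j. j \<le> D \<Longrightarrow> x j = x 0" using Dk by (meson le_less_trans)
  then show "x j0 = x 0" using x degree_le_constant_start by blast
qed

text \<open>
  The sums of squares lie in \<open>{0..<n y^2}\<close>. As the shift \<open>a\<close> runs through the \<open>2 n y^2\<close> integers from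
  \<open>- n y^2\<close>, each digit vector has its sum of squares in \<open>a + S'\<close> for exactly \<open>card S'\<close> values
  of \<open>a\<close>, so some translate of \<open>S'\<close> catches at least the average number of vectors.
\<close>

lemma progression_free_lift:
  fixes n y :: nat
  assumes S': "progression_free k (2 * D) S'" "S' \<subseteq> {0..<int (n * y\<^sup>2)}"
    and Dk: "D < k" and y: "y \<ge> 1" and n: "n \<ge> 1"
  shows "\<exists>S \<subseteq> {0..<(2 ^ (D + 2) * int y) ^ n}. progression_free k D S \<and>
           y ^ n * card S' \<le> 2 * (n * y\<^sup>2) * card S"
proof -
  define B where "B = 2 ^ (D + 2) * int y"
  define M where "M = n * y\<^sup>2"
  define V where "V = {..<n} \<rightarrow>\<^sub>E {0..<int y}"
  define Q where "Q s = (\<Sum>i<n. (s i)\<^sup>2)" for s :: "nat \<Rightarrow> int"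
  define E where "E a = {s \<in> V. Q s - a \<in> S'}" for a
  define I where "I = {- int M..<int M}"
  have finV: "finite V" unfolding V_def by (intro finite_PiE) auto
  have cardV: "card V = y ^ n" by (simp add: V_def card_PiE)
  have M1: "M \<ge> 1" using n y by (simp add: M_def)
  have Qb: "0 \<le> Q s \<and> Q s < int M" if s: "s \<in> V" for s
  proof -
    have "(\<Sum>i<n. (s i)\<^sup>2) < (\<Sum>i<n. (int y)\<^sup>2)"
    proof (rule sum_strict_mono)
      fix i assume "i \<in> {..<n}"
      then have "s i \<in> {0..<int y}" using s unfolding V_def by (rule PiE_mem[rotated])
      then show "(s i)\<^sup>2 < (int y)\<^sup>2" using power_strict_mono[of "s i" "int y" 2] by simp
    qed (use n in \<open>auto simp: lessThan_empty_iff\<close>)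
    then show ?thesis by (auto simp: Q_def M_def intro: sum_nonneg)
  qed
  have cnt: "card {a \<in> I. Q s - a \<in> S'} = card S'" if s: "s \<in> V" for s
  proof -
    have "{a \<in> I. Q s - a \<in> S'} = (\<lambda>t. Q s - t) ` S'"
    proof (intro equalityI subsetI)
      fix a assume "a \<in> (\<lambda>t. Q s - t) ` S'"
      then obtain t where t: "t \<in> S'" "a = Q s - t" by auto
      moreover have "0 \<le> t \<and> t < int M" using t(1) S'(2) by (auto simp: M_def)
      ultimately show "a \<in> {a \<in> I. Q s - a \<in> S'}" using Qb[OF s] by (auto simp: I_def)
    next
      fix a assume "a \<in> {a \<in> I. Q s - a \<in> S'}"
      then show "a \<in> (\<lambda>t. Q s - t) ` S'" by (intro image_eqI[of _ _ "Q s - a"]) auto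
    qed
    then show ?thesis by (simp add: card_image inj_on_def)
  qed
  have "(\<Sum>a\<in>I. card (E a)) = (\<Sum>a\<in>I. \<Sum>s\<in>V. if Q s - a \<in> S' then 1 else 0)"
    by (intro sum.cong) (auto simp: E_def finV sum.If_cases Int_def)
  also have "\<dots> = (\<Sum>s\<in>V. \<Sum>a\<in>I. if Q s - a \<in> S' then 1 else 0)" by (rule sum.swap)
  also have "\<dots> = (\<Sum>s\<in>V. card {a \<in> I. Q s - a \<in> S'})"
    by (intro sum.cong) (auto simp: I_def sum.If_cases Int_def)
  also have "\<dots> = y ^ n * card S'" using cnt by (simp add: cardV)
  finally have tot: "(\<Sum>a\<in>I. card (E a)) = y ^ n * card S'" .
  have "\<exists>a. y ^ n * card S' \<le> 2 * M * card (E a)"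
  proof (rule ccontr)
    assume "\<not> ?thesis"
    then have less: "2 * M * card (E a) < y ^ n * card S'" for a by (auto simp: not_le)
    \<comment> \<open>Double counting: with too few vectors for each of the \<open>2 M\<close> shifts, the total would be too small.\<close>
    have "2 * M * (\<Sum>a\<in>I. card (E a)) < (\<Sum>a\<in>I. y ^ n * card S')"
      unfolding sum_distrib_left using less M1 by (intro sum_strict_mono) (auto simp: I_def)
    also have "\<dots> = 2 * M * (y ^ n * card S')" by (simp add: I_def nat_mult_distrib)
    finally show False using tot by simp
  qed
  then obtain a where a: "y ^ n * card S' \<le> 2 * M * card (E a)" by blast
  define S where "S = digit_sum B n ` E a"
  have By: "2 * int y \<le> B" 
    using power_increasing[of 1 "D + 2" "2::int"] unfolding B_def by (intro mult_right_mono) auto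
  have "inj_on (digit_sum B n) (E a)"
    by (rule inj_on_subset[OF inj_on_digit_sum[of "{0..<int y}" "int y" B n]])
       (use By in \<open>auto simp: E_def V_def\<close>)
  then have "card S = card (E a)" by (simp add: S_def card_image)
  moreover have "progression_free k D S"
    using progression_free_sphere[OF S'(1) Dk, of y n a]
    unfolding S_def B_def E_def V_def Q_def .
  moreover have "S \<subseteq> {0..<B ^ n}"
  proof
    fix w assume "w \<in> S"
    then obtain s where s: "s \<in> V" "w = digit_sum B n s" by (auto simp: S_def E_def)
    have "0 \<le> s i \<and> s i < int y" if "i < n" for i using s(1) that by (force simp: V_def)
    then show "w \<in> {0..<B ^ n}" using digit_sum_bounds[of n s "int y" B] By s(2) by auto
  qed
  ultimately show ?thesis using a unfolding B_def M_def by metis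
qed

text \<open>
  Here \<open>L = ln M\<close> and the base is \<open>K y\<close>. Using only the digits below \<open>y\<close> costs about \<open>n ln K\<close> in the
  exponent, while confining the sum of squares costs \<open>(ln (n y^2)) powr (1/(q+1))\<close>, where \<open>ln y\<close> is
  about \<open>L/n\<close>. Both are of order \<open>L powr \<beta>\<close> when \<open>n\<close> is about \<open>L powr \<beta>\<close>, because
  \<open>(1 - \<beta>)/(q + 1) = \<beta>\<close>.
\<close>

lemma rankin_parameters:
  fixes L K :: real and q :: nat
  defines "\<beta> \<equiv> 1 / (real q + 2)"
  assumes L: "L \<ge> 1" "L \<ge> 4 * (ln K)\<^sup>2" and K: "K \<ge> 1"
  obtains n y :: nat where "n \<ge> 1" "y \<ge> 1" "real n \<le> 2 * L powr \<beta>"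
    "(K * real y) ^ n \<le> exp L" "exp L / (2 * K) ^ n \<le> real y ^ n"
    "ln (real (n * y\<^sup>2)) powr (1 / (real q + 1)) \<le> 4 * L powr \<beta>"
proof -
  define n where "n = nat \<lceil>L powr \<beta>\<rceil>"
  define z where "z = exp (L / n) / K"
  define y where "y = nat \<lfloor>z\<rfloor>"
  have \<beta>: "0 < \<beta>" "\<beta> \<le> 1/2" "1 - \<beta> = (real q + 1) / (real q + 2)"
    by (auto simp: \<beta>_def field_simps)
  have Lb: "1 \<le> L powr \<beta>" using L \<beta> by (simp add: ge_one_powr_ge_zero)
  have n1: "n \<ge> 1" "L powr \<beta> \<le> real n" using Lb unfolding n_def by linarith+
  have n2: "real n \<le> 2 * L powr \<beta>" using Lb unfolding n_def by linarith
  have split: "L = L powr \<beta> * L powr (1 - \<beta>)"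
    using L by (simp flip: powr_add)
  have Ln_le: "L / n \<le> L powr (1 - \<beta>)"
  proof -
    have "L \<le> real n * L powr (1 - \<beta>)"
      using n1(2) by (subst split) (intro mult_right_mono, auto)
    then show ?thesis using n1(1) by (simp add: field_simps)
  qed
  have Ln_ge: "L powr (1 - \<beta>) \<le> 2 * (L / n)"
  proof -
    have "real n * L powr (1 - \<beta>) \<le> 2 * L powr \<beta> * L powr (1 - \<beta>)"
      using n2 by (intro mult_right_mono) auto
    also have "\<dots> = 2 * L" using split by simp
    finally show ?thesis using n1(1) by (simp add: field_simps)
  qed
  have "2 * ln K = sqrt (4 * (ln K)\<^sup>2)" using K by (simp add: real_sqrt_mult)
  also have "\<dots> \<le> sqrt L" using L by (intro real_sqrt_le_mono)
  also have "\<dots> = L powr (1/2)" using L by (simp add: powr_half_sqrt)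
  also have "\<dots> \<le> L powr (1 - \<beta>)" using L \<beta> by (intro powr_mono) auto
  finally have "ln K \<le> L / n" using Ln_ge by simp
  then have "K \<le> exp (L / n)" using K by (metis exp_le_cancel_iff exp_ln less_le_trans zero_less_one)
  then have z1: "1 \<le> z" using K by (simp add: z_def)
  have y1: "y \<ge> 1" using z1 unfolding y_def by linarith
  have "real y = of_int \<lfloor>z\<rfloor>" using z1 by (simp add: y_def)
  then have yz: "real y \<le> z" "z \<le> 2 * real y" using y1 by linarith+
  have expn: "exp (L / n) ^ n = exp L" using n1(1) by (simp flip: exp_of_nat_mult)
  have "(K * real y) ^ n \<le> exp (L / n) ^ n"
    using yz(1) K by (intro power_mono) (auto simp: z_def field_simps)
  then have p1: "(K * real y) ^ n \<le> exp L" by (simp add: expn)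
  have "exp (L / n) ^ n \<le> (2 * K * real y) ^ n"
    using yz(2) K by (intro power_mono) (auto simp: z_def field_simps)
  then have p2: "exp L / (2 * K) ^ n \<le> real y ^ n"
    using K by (simp add: expn field_simps power_mult_distrib)
  have "z \<le> exp (L / n)" using K by (simp add: z_def field_simps)
  then have "ln (real y) \<le> L / n"
    using yz(1) y1 by (metis exp_gt_zero less_le_trans ln_le_cancel_iff ln_exp of_nat_0_less_iff
        order_trans zero_less_one)
  moreover have "ln (real n) \<le> 2 * L powr (1 - \<beta>)"
  proof -
    have "ln (real n) \<le> real n" using n1(1) ln_le_minus_one[of "real n"] by simp
    moreover have "L powr \<beta> \<le> L powr (1 - \<beta>)" using L \<beta> by (intro powr_mono) auto
    ultimately show ?thesis using n2 by linarith
  qed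
  moreover have "ln (real (n * y\<^sup>2)) = ln (real n) + 2 * ln (real y)"
    using n1(1) y1 by (simp add: ln_mult ln_realpow)
  ultimately have "ln (real (n * y\<^sup>2)) \<le> 4 * L powr (1 - \<beta>)" using Ln_le by linarith
  moreover have "0 \<le> ln (real (n * y\<^sup>2))" using n1(1) y1 by (intro ln_ge_zero) (simp add: Suc_le_eq flip: of_nat_mult of_nat_power)
  ultimately have "ln (real (n * y\<^sup>2)) powr (1 / (real q + 1))
      \<le> (4 * L powr (1 - \<beta>)) powr (1 / (real q + 1))"
    by (intro powr_mono2) auto
  also have "\<dots> = 4 powr (1 / (real q + 1)) * L powr \<beta>"
    by (simp add: powr_mult powr_powr \<beta>(3)) (simp add: \<beta>_def)
  also have "\<dots> \<le> 4 powr 1 * L powr \<beta>"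
    by (intro mult_right_mono powr_mono) auto
  finally have "ln (real (n * y\<^sup>2)) powr (1 / (real q + 1)) \<le> 4 * L powr \<beta>" by simp
  from that[OF n1(1) y1 n2 p1 p2 this] show thesis .
qed

text \<open>
  For \<open>q = 0\<close> a single point will do, since the claimed size is \<open>1\<close>. In the step, the induction
  hypothesis is used for degree \<open>2 D\<close>, and its conclusion is lifted through digit vectors
  with the parameters just chosen; every loss is at most a constant times \<open>L powr \<beta>\<close>. Values of \<open>M\<close> that
  are too small for these parameters are covered by a single point and a large constant.
\<close>

theorem rankin_progression_free_sets:
  assumes "2 ^ q * D < k"
  shows "\<exists>c>0. \<forall>M::nat. M \<ge> 1 \<longrightarrow> (\<exists>S \<subseteq> {0..<int M}. progression_free k D S \<and>
           real M * exp (- c * ln (real M) powr (1 / (real q + 1))) \<le> real (card S))"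
  using assms
proof (induction q arbitrary: D)
  case 0
  have "real M * exp (- 1 * ln (real M) powr 1) \<le> real (card {0::int})" if "M \<ge> 1" for M
    using that by (simp add: exp_minus field_simps)
  moreover have "progression_free k D {0}" using 0 by (intro progression_free_singleton) simp
  ultimately have "\<forall>M::nat. M \<ge> 1 \<longrightarrow> (\<exists>S \<subseteq> {0..<int M}. progression_free k D S \<and>
      real M * exp (- 1 * ln (real M) powr 1) \<le> real (card S))"
    by (intro allI impI exI[of _ "{0}"]) auto
  then show ?case by (intro exI[of _ 1]) simp
next
  case (Suc q)
  define K :: real where "K = 2 ^ (D + 2)"
  define \<beta> where "\<beta> = 1 / (real q + 2)"
  define L0 where "L0 = 1 + 4 * (ln K)\<^sup>2"
  have K: "K \<ge> 1" unfolding K_def by (rule one_le_power) simp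
  have \<beta>: "0 < \<beta>" "\<beta> \<le> 1/2" by (auto simp: \<beta>_def field_simps)
  have Dk: "D < k"
    using Suc.prems by (metis le_less_trans mult.commute mult_le_mono2 nat_mult_1_right one_le_numeral one_le_power)
  from Suc.prems have "2 ^ q * (2 * D) < k" by (simp add: algebra_simps)
  from Suc.IH[OF this] obtain c where c: "c > 0" and IH: "\<And>M::nat. M \<ge> 1 \<Longrightarrow>
      \<exists>S \<subseteq> {0..<int M}. progression_free k (2 * D) S \<and>
           real M * exp (- c * ln (real M) powr (1 / (real q + 1))) \<le> real (card S)" by blast
  define c' where "c' = L0 + 2 * ln (2 * K) + 4 * c + ln 2"
  have lnK: "0 \<le> ln (2 * K)" using K by simp
  have c': "c' > 0" "L0 \<le> c'" using c lnK by (auto simp: c'_def L0_def intro!: add_pos_nonneg)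
  have "\<exists>S \<subseteq> {0..<int M}. progression_free k D S \<and>
           real M * exp (- c' * ln (real M) powr \<beta>) \<le> real (card S)" if M: "M \<ge> 1" for M :: nat
  proof -
    define L where "L = ln (real M)"
    have L: "0 \<le> L" "exp L = real M" using M by (auto simp: L_def)
    show ?thesis
    proof (cases "L < L0")
      case True
      have "L \<le> c' * L powr \<beta>"
      proof (cases "L = 0")
        case False
        have "L powr (1 - \<beta>) \<le> L0"
        proof (cases "L \<le> 1")
          case True
          then have "L powr (1 - \<beta>) \<le> 1" using L(1) \<beta> by (intro powr_le1) auto
          moreover have "0 \<le> (ln K)\<^sup>2" by simp
          ultimately show ?thesis unfolding L0_def by linarith
        next
          case False
          then have "L powr (1 - \<beta>) \<le> L powr 1" using \<beta> by (intro powr_mono) auto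
          then show ?thesis using False \<open>L < L0\<close> by simp
        qed
        then have "L powr (1 - \<beta>) * L powr \<beta> \<le> c' * L powr \<beta>"
          using c' by (intro mult_right_mono) auto
        then show ?thesis using L(1) False by (simp flip: powr_add)
      qed simp
      then have "real M * exp (- c' * L powr \<beta>) \<le> exp L * exp (- L)"
        unfolding L(2)[symmetric] by (intro mult_left_mono) auto
      then have "real M * exp (- c' * L powr \<beta>) \<le> real (card {0::int})"
        by (simp flip: exp_add)
      moreover have "progression_free k D {0}" using Dk by (rule progression_free_singleton)
      ultimately show ?thesis using M unfolding L_def by (intro exI[of _ "{0}"]) auto
    next
      case False
      then have LL: "L \<ge> 1" "L \<ge> 4 * (ln K)\<^sup>2" by (auto simp: L0_def not_less intro: order_trans[rotated])
      obtain n y :: nat where ny: "n \<ge> 1" "y \<ge> 1" "real n \<le> 2 * L powr \<beta>"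
        "(K * real y) ^ n \<le> exp L" "exp L / (2 * K) ^ n \<le> real y ^ n"
        "ln (real (n * y\<^sup>2)) powr (1 / (real q + 1)) \<le> 4 * L powr \<beta>"
        using rankin_parameters[OF LL K, of q] unfolding \<beta>_def by metis
      define M' where "M' = n * y\<^sup>2"
      have M': "M' \<ge> 1" using ny by (simp add: M'_def)
      obtain S' where S': "S' \<subseteq> {0..<int M'}" "progression_free k (2 * D) S'"
        "real M' * exp (- c * ln (real M') powr (1 / (real q + 1))) \<le> real (card S')"
        using IH[OF M'] by blast
      obtain S where S: "S \<subseteq> {0..<(2 ^ (D + 2) * int y) ^ n}" "progression_free k D S"
        "y ^ n * card S' \<le> 2 * M' * card S"
        using progression_free_lift[OF S'(2) _ Dk ny(2,1)] S'(1) unfolding M'_def by blast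
      have "real_of_int ((2 ^ (D + 2) * int y) ^ n) \<le> real_of_int (int M)"
        using ny(4) L(2) by (simp add: K_def)
      then have "(2 ^ (D + 2) * int y) ^ n \<le> int M" by (simp only: of_int_le_iff)
      then have "S \<subseteq> {0..<int M}" using S(1) by auto
      moreover have "real M * exp (- c' * L powr \<beta>) \<le> real (card S)"
      proof -
        define e where "e = exp (- (4 * c * L powr \<beta>))"
        have "c * ln (real M') powr (1 / (real q + 1)) \<le> c * (4 * L powr \<beta>)"
          using ny(6) c unfolding M'_def by (intro mult_left_mono) auto
        then have "e \<le> exp (- c * ln (real M') powr (1 / (real q + 1)))" by (simp add: e_def)
        then have "real M' * e \<le> real (card S')"
          using S'(3) by (meson mult_left_mono of_nat_0_le_iff order_trans)
        then have "real y ^ n * (real M' * e) \<le> real y ^ n * real (card S')"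
          by (intro mult_left_mono) auto
        also have "\<dots> \<le> 2 * real M' * real (card S)"
          using S(3) unfolding of_nat_le_iff[symmetric, where 'a = real] by simp
        finally have "real M' * (real y ^ n * e) \<le> real M' * (2 * real (card S))" by (simp add: mult_ac)
        then have 1: "real y ^ n * e \<le> 2 * real (card S)" using M' by simp
        define g where "g = exp L / (2 * K) ^ n"
        have "g * e \<le> real y ^ n * e"
          using ny(5) unfolding g_def by (intro mult_right_mono) (auto simp: e_def)
        then have 2: "g * e / 2 \<le> real (card S)" using 1 by linarith
        have "(2 * K) ^ n = exp (ln (2 * K)) ^ n" using K by simp
        also have "\<dots> = exp (real n * ln (2 * K))" by (simp only: exp_of_nat_mult)
        finally have "g * e / 2 = exp (L - real n * ln (2 * K) - 4 * c * L powr \<beta> - ln 2)"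
          by (simp add: g_def e_def exp_diff exp_minus exp_add field_simps)
        moreover have "real n * ln (2 * K) + 4 * c * L powr \<beta> + ln 2 \<le> c' * L powr \<beta>"
        proof -
          have "real n * ln (2 * K) \<le> 2 * L powr \<beta> * ln (2 * K)"
            using ny(3) lnK by (intro mult_right_mono)
          then have "real n * ln (2 * K) \<le> 2 * ln (2 * K) * L powr \<beta>" by (simp only: mult_ac)
          moreover have "1 \<le> L powr \<beta>" using LL \<beta> by (simp add: ge_one_powr_ge_zero)
          then have "ln 2 * 1 \<le> ln 2 * L powr \<beta>" by (intro mult_left_mono) auto
          moreover have "0 \<le> L0 * L powr \<beta>" by (simp add: L0_def)
          ultimately show ?thesis unfolding c'_def distrib_right by linarith
        qed
        then have "exp (L - c' * L powr \<beta>) \<le> exp (L - real n * ln (2 * K) - 4 * c * L powr \<beta> - ln 2)"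
          by simp
        ultimately have "exp (L - c' * L powr \<beta>) \<le> real (card S)" using 2 by linarith
        then show ?thesis by (simp add: exp_diff exp_minus L(2) field_simps)
      qed
      ultimately show ?thesis using S(2) unfolding L_def by blast
    qed
  qed
  moreover have "\<beta> = 1 / (real (Suc q) + 1)" by (simp add: \<beta>_def)
  ultimately show ?case using c'(1) by metis
qed

section \<open>Cube-free sets\<close>

definition cube_free :: "real \<Rightarrow> nat \<Rightarrow> nat \<Rightarrow> nat \<Rightarrow> (nat \<Rightarrow> nat) set \<Rightarrow> bool" where
  "cube_free \<epsilon> N m k A \<longleftrightarrow> A \<subseteq> grid N m \<and> \<not> (\<exists>X. X \<subseteq> A \<and> approx_cube \<epsilon> N m k X)"

lemma finite_grid: "finite (grid N m)"
  unfolding grid_def by (intro finite_PiE) auto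

lemma card_grid: "card (grid N m) = N ^ m"
  by (simp add: grid_def card_PiE)

lemma max_cube_free_eq: "max_cube_free \<epsilon> N m k = Max (card ` {A. cube_free \<epsilon> N m k A})"
  by (simp add: max_cube_free_def cube_free_def image_Collect)

lemma finite_cube_free: "finite {A. cube_free \<epsilon> N m k A}"
  by (rule finite_subset[of _ "Pow (grid N m)"]) (auto simp: finite_grid cube_free_def)

lemma card_le_max_cube_free: "cube_free \<epsilon> N m k A \<Longrightarrow> card A \<le> max_cube_free \<epsilon> N m k"
  unfolding max_cube_free_eq by (intro Max_ge finite_imageI finite_cube_free) auto

lemma obtain_extremal_set:
  assumes "k \<ge> 1"
  obtains A where "cube_free \<epsilon> N m k A" "card A = max_cube_free \<epsilon> N m k"
proof -
  have "(\<lambda>i\<in>{1..m}. 0) \<in> cube_index m k" using assms by (auto simp: cube_index_def)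
  then have "\<not> approx_cube \<epsilon> N m k {}" unfolding approx_cube_def by blast
  then have "cube_free \<epsilon> N m k {}" by (simp add: cube_free_def)
  then have "max_cube_free \<epsilon> N m k \<in> card ` {A. cube_free \<epsilon> N m k A}"
    unfolding max_cube_free_eq by (intro Max_in finite_imageI finite_cube_free) auto
  then show thesis using that by auto
qed

section \<open>Approximate progressions and the lower bound\<close>

text \<open>
  Let \<open>B^p\<close> be the first power of the base that is at least \<open>8 \<epsilon> d\<close>. Second differences of the \<open>x j\<close>
  are below \<open>4 \<epsilon> d\<close>, so the digits from position \<open>p\<close> on are exact progressions in \<open>S\<close>, hence constant.
  Then \<open>x 1 - x 0\<close> is smaller than \<open>B^p\<close>, which is at most \<open>8 \<epsilon> d B\<close>, at most \<open>d/2\<close>, unless \<open>p = 0\<close> and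
  \<open>x 1 = x 0\<close>; but it must be close to \<open>d\<close>.
\<close>

lemma digit_set_no_approx_progression:
  fixes S :: "int set" and y :: nat and a d \<epsilon> :: real and x :: "nat \<Rightarrow> int"
  assumes S: "S \<subseteq> {0..<int y}" "progression_free k 1 S" and k: "k \<ge> 3" and y: "y \<ge> 1"
  defines "B \<equiv> 8 * int y"
  assumes \<epsilon>: "0 < \<epsilon>" "16 * \<epsilon> * real_of_int B \<le> 1" and d: "d > 0"
    and x: "\<And>j. j < k \<Longrightarrow> x j \<in> digit_sum B n ` ({..<n} \<rightarrow>\<^sub>E S)"
    and close: "\<And>j. j < k \<Longrightarrow> \<bar>real_of_int (x j) - (a + d * real j)\<bar> < \<epsilon> * d"
  shows False
proof -
  have B: "B \<ge> 8" "int y \<le> B - 1" using y by (auto simp: B_def)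
  have "\<forall>j\<in>{..<k}. \<exists>s. s \<in> {..<n} \<rightarrow>\<^sub>E S \<and> x j = digit_sum B n s" using x by auto
  then obtain s where s: "\<And>j. j < k \<Longrightarrow> s j \<in> {..<n} \<rightarrow>\<^sub>E S"
    "\<And>j. j < k \<Longrightarrow> x j = digit_sum B n (s j)"
    by (metis lessThan_iff)
  have sS: "s j i \<in> S" if "j < k" "i < n" for j i
    using PiE_mem[OF s(1)[OF that(1)], of i] that(2) by simp
  have sb: "0 \<le> s j i \<and> s j i < int y" if "j < k" "i < n" for j i
    using sS[OF that] S(1) by auto
  have "\<epsilon> * 128 \<le> \<epsilon> * (16 * real_of_int B)"
    using B \<epsilon>(1) by (intro mult_left_mono) linarith+
  then have e128: "\<epsilon> \<le> 1/128" using \<epsilon>(2) by (simp add: algebra_simps)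
  have "\<exists>p. 8 * \<epsilon> * d \<le> real_of_int B ^ p"
    using real_arch_pow[of "real_of_int B" "8 * \<epsilon> * d"] B by (auto intro: less_imp_le)
  \<comment> \<open>the scale below which the approximation error hides the digits\<close>
  define p where "p = (LEAST p. 8 * \<epsilon> * d \<le> real_of_int B ^ p)"
  have p: "8 * \<epsilon> * d \<le> real_of_int B ^ p"
    unfolding p_def using \<open>\<exists>p. _\<close> by (rule LeastI_ex)
  have high: "s 1 i = s 0 i" if i: "p \<le> i" "i < n" for i
  proof -
    have "\<exists>z. degree_le 1 z \<and> (\<forall>j<k. z j = s j i)"
    proof (rule high_digit_degree_le[of k n s y 1 p i])
      fix j assume j: "j + Suc 1 < k"
      have "(fdiff ^^ Suc 1) (\<lambda>j. digit_sum B n (s j)) j = (fdiff ^^ Suc 1) x j"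
        using j by (intro fdiff_funpow_cong) (simp add: s(2))
      also have "\<dots> = x (j + 2) - 2 * x (j + 1) + x j" by (simp add: fdiff_def)
      finally have eq: "(fdiff ^^ Suc 1) (\<lambda>j. digit_sum B n (s j)) j
        = x (j + 2) - 2 * x (j + 1) + x j" .
      have "2 * \<bar>real_of_int (x (j + 2) - 2 * x (j + 1) + x j)\<bar> < 8 * \<epsilon> * d"
        using close[of j] close[of "j+1"] close[of "j+2"] j by (simp add: algebra_simps abs_less_iff)
      also note p
      finally have "real_of_int (2 * \<bar>x (j + 2) - 2 * x (j + 1) + x j\<bar>) < real_of_int (B ^ p)" by simp
      then have sm: "2 * \<bar>x (j + 2) - 2 * x (j + 1) + x j\<bar> < B ^ p" by (simp only: of_int_less_iff)
      have B8: "2 ^ (1 + 2) * int y = B" by (simp add: B_def)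
      show "2 * \<bar>(fdiff ^^ Suc 1) (\<lambda>j. digit_sum (2 ^ (1 + 2) * int y) n (s j)) j\<bar>
          < (2 ^ (1 + 2) * int y) ^ p"
        unfolding B8 eq by (rule sm)
    qed (use sb i in auto)
    then obtain z where z: "degree_le 1 z" "\<And>j. j < k \<Longrightarrow> z j = s j i" by blast
    have "\<forall>j<k. z j \<in> S" using z(2) sS i by simp
    then have "z 1 = z 0" using S(2) z(1) unfolding progression_free_def by blast
    then show ?thesis using z(2)[of 1] z(2)[of 0] k by simp
  qed
  define r where "r = min p n"
  have "x 1 - x 0 = digit_sum B n (\<lambda>i. s 1 i - s 0 i)"
    using s(2)[of 1] s(2)[of 0] k by (simp add: digit_sum_diff)
  also have "\<dots> = digit_sum B r (\<lambda>i. s 1 i - s 0 i)"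
    unfolding digit_sum_def r_def using high
    by (intro sum.mono_neutral_right) (auto simp: not_less min_def split: if_splits)
  also have "\<bar>\<dots>\<bar> \<le> (B - 1) * (\<Sum>i<r. B ^ i)"
  proof (rule abs_digit_sum_le)
    fix i assume "i < r"
    then have "0 \<le> s 1 i \<and> s 1 i < int y" "0 \<le> s 0 i \<and> s 0 i < int y"
      using k by (auto simp: r_def intro!: sb)
    then show "\<bar>s 1 i - s 0 i\<bar> \<le> B - 1" using B by linarith
  qed (use B in simp)
  also have "\<dots> = B ^ r - 1" by (rule geometric_sum_int)
  also have "B ^ r - 1 \<le> B ^ p - 1"
  proof -
    have "r \<le> p" "1 \<le> B" using B by (auto simp: r_def)
    then have "B ^ r \<le> B ^ p" by (rule power_increasing)
    then show ?thesis by linarith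
  qed
  finally have "real_of_int \<bar>x 1 - x 0\<bar> \<le> real_of_int (B ^ p - 1)" by (simp only: of_int_le_iff)
  then have up: "\<bar>real_of_int (x 1) - real_of_int (x 0)\<bar> \<le> real_of_int B ^ p - 1" by simp
  have "d - 2 * (\<epsilon> * d) < real_of_int (x 1) - real_of_int (x 0)"
    using close[of 0] close[of 1] k by (simp add: abs_less_iff)
  moreover have "\<epsilon> * d \<le> 1/128 * d" using e128 d by (intro mult_right_mono) auto
  ultimately have low: "d / 2 < real_of_int B ^ p - 1" using up d by linarith
  show False
  proof (cases p)
    case 0
    then show False using low d by simp
  next
    case (Suc p')
    have "\<not> 8 * \<epsilon> * d \<le> real_of_int B ^ p'"
      using not_less_Least[of p' "\<lambda>p. 8 * \<epsilon> * d \<le> real_of_int B ^ p"] Suc unfolding p_def by simp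
    then have "real_of_int B * real_of_int B ^ p' \<le> real_of_int B * (8 * \<epsilon> * d)"
      using B by (intro mult_left_mono) auto
    also have "\<dots> = (16 * \<epsilon> * real_of_int B) * (d / 2)" by simp
    also have "\<dots> \<le> 1 * (d / 2)" using \<epsilon>(2) d by (intro mult_right_mono) auto
    finally show False using low Suc by simp
  qed
qed

text \<open>
  The set is \<open>T \<times> [N] \<times> ... \<times> [N]\<close>. The vertices \<open>(j, 0, ..., 0)\<close> of a cube inside it have
  first coordinates that form an approximate progression in \<open>T\<close>.
\<close>

lemma max_cube_free_ge_product:
  assumes T: "T \<subseteq> {1..N}" and m: "m \<ge> 1" and k: "k \<ge> 1"
    and free: "\<And>x a d. \<lbrakk>d > 0; \<And>j. j < k \<Longrightarrow> x j \<in> T;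
                 \<And>j. j < k \<Longrightarrow> \<bar>real (x j) - (a + d * real j)\<bar> < \<epsilon> * d\<rbrakk> \<Longrightarrow> False"
  shows "N ^ (m - 1) * card T \<le> max_cube_free \<epsilon> N m k"
proof -
  define A where "A = (\<Pi>\<^sub>E i\<in>{1..m}. if i = 1 then T else {1..N})"
  have "{1..m} = insert 1 {2..m}" using m by auto
  then have "card A = card T * (\<Prod>i\<in>{2..m}. card (if i = 1 then T else {1..N}))"
    by (simp add: A_def card_PiE)
  also have "(\<Prod>i\<in>{2..m}. card (if i = 1 then T else {1..N})) = (\<Prod>i\<in>{2..m}. N)"
    by (intro prod.cong) auto
  finally have "card A = N ^ (m - 1) * card T" by simp
  moreover have "card A \<le> max_cube_free \<epsilon> N m k"
  proof (rule card_le_max_cube_free, unfold cube_free_def, intro conjI notI)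
    show "A \<subseteq> grid N m" unfolding A_def grid_def using T by (intro PiE_mono) auto
    assume "\<exists>X. X \<subseteq> A \<and> approx_cube \<epsilon> N m k X"
    then obtain X where XA: "X \<subseteq> A" and "approx_cube \<epsilon> N m k X" by blast
    show False
    proof -
      from \<open>approx_cube \<epsilon> N m k X\<close>
      obtain x a d where X: "X = x ` cube_index m k" and d: "d > 0"
        and close: "\<And>v. v \<in> cube_index m k \<Longrightarrow>
           L2_set (\<lambda>i. real (x v i) - (a i + d * real (v i))) {1..m} < \<epsilon> * d"
        unfolding approx_cube_def by blast
      define v where "v j = (\<lambda>i\<in>{1..m}. if i = 1 then j else 0)" for j :: nat
      have v: "v j \<in> cube_index m k" "v j 1 = j" if "j < k" for j
        using that m by (auto simp: v_def cube_index_def)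
      have "x (v j) 1 \<in> T" if "j < k" for j
      proof -
        have "x (v j) \<in> A" using v(1)[OF that] X XA by blast
        then have "x (v j) 1 \<in> (if (1::nat) = 1 then T else {1..N})"
          unfolding A_def using m by (intro PiE_mem[of "x (v j)" "{1..m}"]) auto
        then show ?thesis by simp
      qed
      moreover have "\<bar>real (x (v j) 1) - (a 1 + d * real j)\<bar> < \<epsilon> * d" if "j < k" for j
      proof -
        have "\<bar>real (x (v j) 1) - (a 1 + d * real (v j 1))\<bar>
          \<le> L2_set (\<lambda>i. \<bar>real (x (v j) i) - (a i + d * real (v j i))\<bar>) {1..m}"
          using m by (intro member_le_L2_set) auto
        also have "\<dots> = L2_set (\<lambda>i. real (x (v j) i) - (a i + d * real (v j i))) {1..m}"
          by (simp add: L2_set_def)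
        also have "\<dots> < \<epsilon> * d" using close v(1)[OF that] by blast
        finally show ?thesis using v(2)[OF that] by simp
      qed
      ultimately show False using free[OF d, of "\<lambda>j. x (v j) 1" "a 1"] by blast
    qed
  qed
  ultimately show ?thesis by simp
qed

lemma max_cube_free_ge_trivial:
  assumes "N \<ge> 1" "m \<ge> 1" "k \<ge> 2" "\<epsilon> < 1/2"
  shows "N ^ (m - 1) \<le> max_cube_free \<epsilon> N m k"
proof -
  have "N ^ (m - 1) * card {1::nat} \<le> max_cube_free \<epsilon> N m k"
  proof (rule max_cube_free_ge_product)
    fix x :: "nat \<Rightarrow> nat" and a d :: real
    assume d: "d > 0" and x: "\<And>j. j < k \<Longrightarrow> x j \<in> {1}"
      and close: "\<And>j. j < k \<Longrightarrow> \<bar>real (x j) - (a + d * real j)\<bar> < \<epsilon> * d"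
    have "d < 2 * (\<epsilon> * d)" using close[of 0] close[of 1] x[of 0] x[of 1] assms by simp
    moreover have "\<epsilon> * d \<le> 1/2 * d" using assms d by (intro mult_right_mono) auto
    ultimately show False by linarith
  qed (use assms in auto)
  then show ?thesis by simp
qed

lemma max_cube_free_ge_digits:
  assumes S: "S \<subseteq> {0..<int y}" "progression_free k 1 S" and k: "k \<ge> 3" and y: "y \<ge> 1"
    and \<epsilon>: "0 < \<epsilon>" "128 * \<epsilon> * real y \<le> 1" and N: "(8 * y) ^ n \<le> N" and m: "m \<ge> 1"
  shows "N ^ (m - 1) * card S ^ n \<le> max_cube_free \<epsilon> N m k"
proof -
  define B where "B = 8 * int y"
  define T0 where "T0 = digit_sum B n ` ({..<n} \<rightarrow>\<^sub>E S)"
  define T where "T = (\<lambda>w. Suc (nat w)) ` T0"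
  have T0: "0 \<le> w \<and> w < int N" if w: "w \<in> T0" for w
  proof -
    obtain s where s: "s \<in> {..<n} \<rightarrow>\<^sub>E S" "w = digit_sum B n s" using w unfolding T0_def by blast
    have "0 \<le> s i \<and> s i < int y" if "i < n" for i
      using PiE_mem[OF s(1), of i] S(1) that by auto
    then have "0 \<le> w" "w < B ^ n" using digit_sum_bounds[of n s "int y" B] s(2) by (auto simp: B_def)
    moreover have "B ^ n = int ((8 * y) ^ n)" by (simp add: B_def)
    then have "B ^ n \<le> int N" using N by (simp only: of_nat_le_iff)
    ultimately show ?thesis by linarith
  qed
  have "inj_on (digit_sum B n) ({..<n} \<rightarrow>\<^sub>E S)"
    by (rule inj_on_digit_sum[OF S(1)]) (simp add: B_def)
  then have "card T0 = card S ^ n" by (simp add: T0_def card_image card_PiE)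
  moreover have "inj_on (\<lambda>w. Suc (nat w)) T0" 
    by (rule inj_onI) (metis T0 nat.inject int_nat_eq)
  ultimately have card: "card T = card S ^ n" by (simp add: T_def card_image)
  have "N ^ (m - 1) * card T \<le> max_cube_free \<epsilon> N m k"
  proof (rule max_cube_free_ge_product)
    show "T \<subseteq> {1..N}" using T0 by (force simp: T_def)
    fix x :: "nat \<Rightarrow> nat" and a d :: real
    assume d: "d > 0" and x: "\<And>j. j < k \<Longrightarrow> x j \<in> T"
      and close: "\<And>j. j < k \<Longrightarrow> \<bar>real (x j) - (a + d * real j)\<bar> < \<epsilon> * d"
    show False
    proof (rule digit_set_no_approx_progression[OF S k y \<epsilon>(1) _ d])
      show "16 * \<epsilon> * real_of_int (8 * int y) \<le> 1" using \<epsilon>(2) by simp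
      fix j assume j: "j < k"
      show "int (x j) - 1 \<in> digit_sum (8 * int y) n ` ({..<n} \<rightarrow>\<^sub>E S)"
        using x[OF j] T0 unfolding T_def T0_def[symmetric] B_def[symmetric] by auto
      show "\<bar>real_of_int (int (x j) - 1) - ((a - 1) + d * real j)\<bar> < \<epsilon> * d"
        using close[OF j] by simp
    qed
  qed (use m k in auto)
  then show ?thesis by (simp add: card)
qed

text \<open>
  With base \<open>B = 8 y\<close> between \<open>exp (\<Lambda>/2)\<close> and \<open>exp \<Lambda>\<close> and \<open>n\<close> digits, where \<open>n\<close> is the integer part of
  \<open>ln N / ln B\<close>, each digit loses at most a constant times \<open>\<Lambda> powr \<alpha>\<close> in the logarithm of the size; since
  \<open>n \<le> 2 ln N / \<Lambda>\<close>, the total loss is of order \<open>ln N * \<Lambda> powr (\<alpha> - 1)\<close>. Rounding \<open>N\<close> down to a power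
  of \<open>B\<close> loses at most \<open>\<Lambda>\<close>, and the lower bound on \<open>N\<close> makes this negligible as well. When \<open>\<Lambda> < 20\<close> the
  constant is so large that the claimed bound is at most \<open>N powr (m - 1)\<close>.
\<close>

lemma lower_bound:
  assumes q: "2 ^ q < k" and k: "k \<ge> 3"
  shows "\<exists>c>0. \<forall>\<epsilon> N m. 0 < \<epsilon> \<longrightarrow> \<epsilon> < 1/125 \<longrightarrow> real N \<ge> exp ((ln (1/\<epsilon>))\<^sup>2) \<longrightarrow> m \<ge> 1 \<longrightarrow>
           real N powr (real m - c * ln (1/\<epsilon>) powr (1 / (real q + 1) - 1))
             \<le> real (max_cube_free \<epsilon> N m k)"
proof -
  obtain c0 where c0: "c0 > 0" and R: "\<And>M::nat. M \<ge> 1 \<Longrightarrow>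
      \<exists>S \<subseteq> {0..<int M}. progression_free k 1 S \<and>
           real M * exp (- c0 * ln (real M) powr (1 / (real q + 1))) \<le> real (card S)"
    using rankin_progression_free_sets[of q 1 k] q by auto
  define \<alpha> where "\<alpha> = 1 / (real q + 1)"
  define c1 where "c1 = c0 + ln 8"
  define c where "c = 2 * c1 + 21"
  have \<alpha>: "0 < \<alpha>" "\<alpha> \<le> 1" by (auto simp: \<alpha>_def field_simps)
  have c1: "c1 > 0" using c0 by (simp add: c1_def add_pos_nonneg)
  have "real N powr (real m - c * ln (1/\<epsilon>) powr (\<alpha> - 1)) \<le> real (max_cube_free \<epsilon> N m k)"
    if \<epsilon>: "0 < \<epsilon>" "\<epsilon> < 1/125" and N: "real N \<ge> exp ((ln (1/\<epsilon>))\<^sup>2)" and m: "m \<ge> 1" for \<epsilon> N m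
  proof -
    define \<Lambda> where "\<Lambda> = ln (1/\<epsilon>)"
    have e\<Lambda>: "exp \<Lambda> = 1 / \<epsilon>" using \<epsilon> by (simp add: \<Lambda>_def)
    have "exp 1 \<le> (3::real)" using exp_le by simp
    also have "(3::real) \<le> 1 / \<epsilon>" using \<epsilon> by (simp add: field_simps)
    finally have \<Lambda>1: "1 \<le> \<Lambda>" unfolding e\<Lambda>[symmetric] by simp
    have N1: "1 < real N" using N \<Lambda>1
      by (smt (verit) one_less_exp_iff zero_less_power2 \<Lambda>_def)
    define n0 where "n0 = ln (real N)"
    have n0: "0 < n0" "\<Lambda>\<^sup>2 \<le> n0" using N1 N unfolding n0_def \<Lambda>_def
      by (auto simp: ln_ge_iff)
    define P where "P = \<Lambda> powr (\<alpha> - 1)"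
    have P0: "0 < P" using \<Lambda>1 by (simp add: P_def)
    have P\<Lambda>: "\<Lambda> powr \<alpha> = P * \<Lambda>" using \<Lambda>1 by (simp add: P_def powr_diff)
    have red: ?thesis if "real N powr (1 - c * P) * real N ^ (m - 1) \<le> real (max_cube_free \<epsilon> N m k)"
    proof -
      have "real N powr (real m - c * P) = real N powr ((1 - c * P) + real (m - 1))"
        using m by (simp add: of_nat_diff algebra_simps)
      also have "\<dots> = real N powr (1 - c * P) * real N ^ (m - 1)"
        using N1 by (simp add: powr_add powr_realpow)
      finally show ?thesis using that by (simp add: P_def \<Lambda>_def)
    qed
    show ?thesis
    proof (cases "\<Lambda> < 20")
      case True
      have "1 = \<Lambda> powr (1 - \<alpha>) * P" using \<Lambda>1 by (simp add: P_def flip: powr_add)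
      also have "\<dots> \<le> \<Lambda> powr 1 * P" using \<Lambda>1 \<alpha> P0 by (intro mult_right_mono powr_mono) auto
      also have "\<dots> \<le> c * P" using True \<Lambda>1 P0 c1 by (intro mult_right_mono) (auto simp: c_def)
      finally have "real N powr (1 - c * P) \<le> real N powr 0" using N1 by (intro powr_mono) auto
      then have "real N powr (1 - c * P) * real N ^ (m - 1) \<le> 1 * real N ^ (m - 1)"
        using N1 by (intro mult_right_mono) auto
      also have "\<dots> \<le> real (max_cube_free \<epsilon> N m k)"
        using max_cube_free_ge_trivial[of N m k \<epsilon>] N1 m k \<epsilon>
        by (simp flip: of_nat_power)
      finally show ?thesis by (rule red)
    next
      case False
      define z where "z = exp \<Lambda> / 128"
      define y where "y = nat \<lfloor>z\<rfloor>"
      \<comment> \<open>The number \<open>1024\<close> leaves room for the factor \<open>1/16\<close> between \<open>8 z\<close> and \<open>exp \<Lambda>\<close> and for rounding \<open>z\<close> down.\<close>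
      have "1024 = (2::real) ^ 10" by simp
      also have "\<dots> \<le> exp 1 ^ 10" using exp_ge_add_one_self[of 1] by (intro power_mono) auto
      also have "\<dots> = exp (10::real)" by (simp flip: exp_of_nat_mult)
      also have "\<dots> \<le> exp (\<Lambda> / 2)" using False by simp
      finally have half: "1024 \<le> exp (\<Lambda> / 2)" .
      have sq: "exp (\<Lambda> / 2) * exp (\<Lambda> / 2) = exp \<Lambda>" by (simp flip: exp_add)
      have "1024 * exp (\<Lambda> / 2) \<le> exp \<Lambda>" unfolding sq[symmetric]
        using half by (intro mult_right_mono) auto
      then have z1: "exp (\<Lambda> / 2) \<le> 8 * (z - 1)" "1 \<le> z" using half by (auto simp: z_def)
      have y1: "y \<ge> 1" using z1(2) unfolding y_def by linarith
      have "real y = of_int \<lfloor>z\<rfloor>" using z1 by (simp add: y_def)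
      then have yz: "real y \<le> z" "z - 1 \<le> real y" by linarith+
      define B where "B = 8 * real y"
      have B: "B \<le> exp \<Lambda>" "exp (\<Lambda> / 2) \<le> B" "B > 0"
      proof -
        show "exp (\<Lambda> / 2) \<le> B" using yz(2) z1(1) unfolding B_def by argo
        show "B > 0" using y1 by (simp add: B_def)
        have "8 * z \<le> exp \<Lambda>" by (simp add: z_def)
        then show "B \<le> exp \<Lambda>" using yz(1) unfolding B_def by argo
      qed
      have lnB: "\<Lambda> / 2 \<le> ln B" "ln B \<le> \<Lambda>"
      proof -
        show "\<Lambda> / 2 \<le> ln B" using B ln_ge_iff[of B "\<Lambda> / 2"] by blast
        have "ln B \<le> ln (exp \<Lambda>)" using B by (subst ln_le_cancel_iff) auto
        then show "ln B \<le> \<Lambda>" by simp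
      qed
      have lny: "0 \<le> ln (real y)" "ln (real y) \<le> \<Lambda>"
      proof -
        show "0 \<le> ln (real y)" using y1 by simp
        have "ln B = ln 8 + ln (real y)" using y1 by (simp add: B_def ln_mult)
        moreover have "0 \<le> ln (8::real)" by simp
        ultimately show "ln (real y) \<le> \<Lambda>" using lnB(2) by linarith
      qed
      obtain S where S: "S \<subseteq> {0..<int y}" "progression_free k 1 S"
        "real y * exp (- c0 * ln (real y) powr \<alpha>) \<le> real (card S)"
        using R[OF y1] unfolding \<alpha>_def by blast
      have cS: "B * exp (- (c1 * (P * \<Lambda>))) \<le> real (card S)"
      proof -
        have "1 \<le> \<Lambda> powr \<alpha>" using \<Lambda>1 \<alpha> by (simp add: ge_one_powr_ge_zero)
        then have "ln 8 * 1 \<le> ln 8 * \<Lambda> powr \<alpha>" by (intro mult_left_mono) auto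
        moreover have "c0 * ln (real y) powr \<alpha> \<le> c0 * \<Lambda> powr \<alpha>"
          using lny \<alpha> c0 by (intro mult_left_mono powr_mono2) auto
        ultimately have "ln 8 + c0 * ln (real y) powr \<alpha> \<le> c1 * (P * \<Lambda>)"
          unfolding P\<Lambda>[symmetric] c1_def distrib_right by linarith
        then have "exp (- (c1 * (P * \<Lambda>))) \<le> exp (- (ln 8 + c0 * ln (real y) powr \<alpha>))" by simp
        also have "\<dots> = exp (- c0 * ln (real y) powr \<alpha>) / 8"
          by (simp add: exp_add exp_minus exp_diff field_simps)
        finally have "B * exp (- (c1 * (P * \<Lambda>))) \<le> B * (exp (- c0 * ln (real y) powr \<alpha>) / 8)"
          using B by (intro mult_left_mono) auto
        also have "\<dots> \<le> real (card S)" using S(3) by (simp add: B_def)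
        finally show ?thesis .
      qed
      define n where "n = nat \<lfloor>n0 / ln B\<rfloor>"
      have lB0: "0 < ln B" using lnB \<Lambda>1 by linarith
      have "real n = of_int \<lfloor>n0 / ln B\<rfloor>" using n0 lB0 by (simp add: n_def)
      then have "real n \<le> n0 / ln B" "n0 / ln B - 1 \<le> real n" by linarith+
      then have n: "real n * ln B \<le> n0" "n0 - ln B \<le> real n * ln B"
        using lB0 by (auto simp: field_simps)
      have "B ^ n = exp (ln B) ^ n" using B by simp
      also have "\<dots> = exp (real n * ln B)" by (simp only: exp_of_nat_mult)
      finally have Bn: "B ^ n = exp (real n * ln B)" .
      have "B ^ n \<le> real N" unfolding Bn using n(1) N1 unfolding n0_def
        by (metis exp_le_cancel_iff exp_ln less_trans zero_less_one)
      then have "real ((8 * y) ^ n) \<le> real N" by (simp add: B_def)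
      then have Nn: "(8 * y) ^ n \<le> N" by (simp only: of_nat_le_iff)
      have ey: "128 * \<epsilon> * real y \<le> 1"
        using yz(1) \<epsilon> unfolding z_def e\<Lambda> by (simp add: field_simps)
      have "real (N ^ (m - 1) * card S ^ n) \<le> real (max_cube_free \<epsilon> N m k)"
        using max_cube_free_ge_digits[OF S(1,2) k y1 \<epsilon>(1) ey Nn m] by (simp only: of_nat_le_iff)
      moreover have "real N powr (1 - c * P) \<le> real (card S) ^ n"
      proof -
        have "exp (real n * ln B - real n * (c1 * (P * \<Lambda>))) = B ^ n * exp (- (c1 * (P * \<Lambda>))) ^ n"
          by (simp add: Bn exp_diff exp_minus exp_of_nat_mult[symmetric] field_simps)
        also have "\<dots> = (B * exp (- (c1 * (P * \<Lambda>)))) ^ n" by (simp add: power_mult_distrib)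
        also have "\<dots> \<le> real (card S) ^ n" using cS B by (intro power_mono) auto
        finally have 1: "exp (real n * ln B - real n * (c1 * (P * \<Lambda>))) \<le> real (card S) ^ n" .
        have "real n * (\<Lambda> / 2) \<le> real n * ln B" using lnB by (intro mult_left_mono) auto
        then have "real n * \<Lambda> \<le> 2 * n0" using n(1) by linarith
        then have "(real n * \<Lambda>) * (c1 * P) \<le> 2 * n0 * (c1 * P)"
          using c1 P0 by (intro mult_right_mono) auto
        moreover have "ln B \<le> n0 * P"
        proof -
          have "\<Lambda> = \<Lambda>\<^sup>2 * \<Lambda> powr (- 1)" using \<Lambda>1 by (simp add: powr_minus power2_eq_square)
          also have "\<dots> \<le> n0 * P" unfolding P_def
            using n0 \<Lambda>1 \<alpha> by (intro mult_mono powr_mono) auto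
          finally show ?thesis using lnB by linarith
        qed
        moreover have "0 \<le> n0 * P" using n0 P0 by simp
        ultimately have "n0 * (1 - c * P) \<le> real n * ln B - real n * (c1 * (P * \<Lambda>))"
          using n(2) unfolding c_def by (simp add: algebra_simps)
        then have "exp (n0 * (1 - c * P)) \<le> real (card S) ^ n"
          using 1 by (meson exp_le_cancel_iff order_trans)
        then show ?thesis using N1 by (simp add: powr_def n0_def mult.commute)
      qed
      then have "real N powr (1 - c * P) * real N ^ (m - 1) \<le> real (card S) ^ n * real N ^ (m - 1)"
        by (intro mult_right_mono) auto
      ultimately have "real N powr (1 - c * P) * real N ^ (m - 1) \<le> real (max_cube_free \<epsilon> N m k)"
        by (simp add: mult.commute)
      then show ?thesis by (rule red)
    qed
  qed
  moreover have "c > 0" using c1 by (simp add: c_def)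
  ultimately show ?thesis unfolding \<alpha>_def by blast
qed

section \<open>Counting occupied cells and the upper bound\<close>

text \<open>
  This is the only way in which cube-freeness is used for the upper bound. The Euclidean norm is
  bounded by the sum of the coordinates, whence the factor \<open>m\<close>; exact cubes are the case \<open>r = 0\<close>.
\<close>

lemma cube_free_misses_vertex:
  assumes A: "cube_free \<epsilon> N m k A" and d: "d > 0" and r: "real m * r < \<epsilon> * d"
  shows "\<exists>v\<in>cube_index m k. \<forall>x\<in>A. \<exists>i\<in>{1..m}. \<not> \<bar>real (x i) - (a i + d * real (v i))\<bar> \<le> r"
proof (rule ccontr)
  assume "\<not> ?thesis"
  then have "\<forall>v\<in>cube_index m k. \<exists>x. x \<in> A \<and> (\<forall>i\<in>{1..m}. \<bar>real (x i) - (a i + d * real (v i))\<bar> \<le> r)"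
    by blast
  then obtain x where x: "\<And>v. v \<in> cube_index m k \<Longrightarrow> x v \<in> A"
    "\<And>v i. v \<in> cube_index m k \<Longrightarrow> i \<in> {1..m} \<Longrightarrow> \<bar>real (x v i) - (a i + d * real (v i))\<bar> \<le> r"
    by (metis bchoice)
  define a' where "a' = restrict a {1..m}"
  have "L2_set (\<lambda>i. real (x v i) - (a' i + d * real (v i))) {1..m} < \<epsilon> * d"
    if v: "v \<in> cube_index m k" for v
  proof -
    have "L2_set (\<lambda>i. real (x v i) - (a' i + d * real (v i))) {1..m}
        \<le> (\<Sum>i\<in>{1..m}. \<bar>real (x v i) - (a' i + d * real (v i))\<bar>)"
      by (rule L2_set_le_sum_abs)
    also have "\<dots> \<le> (\<Sum>i\<in>{1..m}. r)" using x(2)[OF v] by (intro sum_mono) (auto simp: a'_def)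
    also have "\<dots> < \<epsilon> * d" using r by simp
    finally show ?thesis .
  qed
  moreover have "a' \<in> {1..m} \<rightarrow>\<^sub>E (UNIV :: real set)" by (auto simp: a'_def)
  moreover have "x ` cube_index m k \<subseteq> A" using x(1) by blast
  moreover have "A \<subseteq> grid N m" using A by (simp add: cube_free_def)
  ultimately have "approx_cube \<epsilon> N m k (x ` cube_index m k)"
    unfolding approx_cube_def using d by blast
  then show False using A \<open>x ` cube_index m k \<subseteq> A\<close> unfolding cube_free_def by blast
qed

text \<open>
  Every point of the box \<open>{0..<k h}^m\<close> is \<open>u + h v\<close> for a unique pair, so the box is the disjoint union of
  \<open>h^m\<close> dilated cubes, one for each \<open>u\<close>, and \<open>P\<close> misses a point of each.
\<close>

lemma card_pattern_free:
  fixes P :: "(nat \<Rightarrow> nat) set"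
  assumes P: "P \<subseteq> {1..m} \<rightarrow>\<^sub>E {0..<k * h}" and h: "h \<ge> 1"
    and miss: "\<And>u. u \<in> {1..m} \<rightarrow>\<^sub>E {0..<h} \<Longrightarrow>
                 \<exists>v\<in>cube_index m k. (\<lambda>i\<in>{1..m}. u i + h * v i) \<notin> P"
  shows "card P + h ^ m \<le> (k * h) ^ m"
proof -
  define U where "U = {1..m} \<rightarrow>\<^sub>E {0..<h}"
  define Q where "Q = {1..m} \<rightarrow>\<^sub>E {0..<k * h}"
  have fin: "finite U" "finite Q" unfolding U_def Q_def by (auto intro: finite_PiE)
  have cardU: "card U = h ^ m" and cardQ: "card Q = (k * h) ^ m"
    by (simp_all add: U_def Q_def card_PiE)
  obtain v where v: "\<And>u. u \<in> U \<Longrightarrow> v u \<in> cube_index m k"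
    "\<And>u. u \<in> U \<Longrightarrow> (\<lambda>i\<in>{1..m}. u i + h * v u i) \<notin> P"
    using miss unfolding U_def by metis
  define f where "f u = (\<lambda>i\<in>{1..m}. u i + h * v u i)" for u
  have "inj_on f U"
  proof (rule inj_onI)
    fix u u' assume u: "u \<in> U" and u': "u' \<in> U" and eq: "f u = f u'"
    show "u = u'"
    proof (rule PiE_ext[OF u[unfolded U_def] u'[unfolded U_def]])
      fix i assume i: "i \<in> {1..m}"
      have "u i < h" "u' i < h" using u u' i by (auto simp: U_def)
      then have "f u i mod h = u i" "f u' i mod h = u' i" using i by (auto simp: f_def)
      then show "u i = u' i" using eq by simp
    qed
  qed
  moreover have "f ` U \<subseteq> Q - P"
  proof
    fix w assume "w \<in> f ` U"
    then obtain u where u: "u \<in> U" "w = f u" by auto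
    have "u i + h * v u i < k * h" if i: "i \<in> {1..m}" for i
    proof -
      have "u i < h" using u(1) i by (auto simp: U_def)
      moreover have "v u i < k" using v(1)[OF u(1)] i by (auto simp: cube_index_def)
      then have "h * (v u i + 1) \<le> h * k" by (intro mult_le_mono2) simp
      ultimately show ?thesis by (simp add: algebra_simps)
    qed
    then have "w \<in> Q" unfolding u(2) f_def Q_def by auto
    then show "w \<in> Q - P" using v(2)[OF u(1)] u(2) by (simp add: f_def)
  qed
  ultimately have "h ^ m \<le> card (Q - P)"
    using card_mono[of "Q - P" "f ` U"] fin cardU by (simp add: card_image)
  moreover have "card (Q - P) + card P = card Q"
    using P fin by (simp add: Q_def card_Diff_subset finite_subset card_mono)
  ultimately show ?thesis using cardQ by simp
qed

definition cell :: "nat \<Rightarrow> nat \<Rightarrow> (nat \<Rightarrow> nat) \<Rightarrow> nat \<Rightarrow> nat" where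
  "cell m s x = (\<lambda>i\<in>{1..m}. x i div s)"

text \<open>
  Inside one cell of side \<open>s k h\<close>, the occupied cells of side \<open>s\<close> form a subset of a box
  \<open>{0..<k h}^m\<close>. If all \<open>u + h v\<close> were occupied for some \<open>u\<close>, points in these cells would be within
  \<open>s - 1\<close> of an exact cube with side \<open>s h\<close> in each coordinate, an error allowed by \<open>m \<le> \<epsilon> h\<close>.
\<close>

lemma card_cells_step:
  assumes A: "cube_free \<epsilon> N m k A" and m: "m \<ge> 1" and k: "k \<ge> 1" and s: "s \<ge> 1"
    and \<epsilon>: "\<epsilon> > 0" and h: "real m \<le> \<epsilon> * real h"
  shows "card (cell m s ` A) \<le> ((k * h) ^ m - h ^ m) * card (cell m (s * (k * h)) ` A)"
proof -
  have "0 < \<epsilon> * real h" using h m by linarith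
  then have h1: "h \<ge> 1" using \<epsilon> by (simp add: zero_less_mult_iff)
  define b where "b = k * h"
  have b0: "b > 0" using k h1 by (simp add: b_def)
  define Y where "Y = cell m s ` A"
  have "A \<subseteq> grid N m" using A by (simp add: cube_free_def)
  then have finA: "finite A" using finite_grid finite_subset by blast
  then have finY: "finite Y" by (simp add: Y_def)
  have cc: "cell m b (cell m s x) = cell m (s * b) x" for x
    by (auto simp: cell_def div_mult2_eq)
  have img: "cell m b ` Y = cell m (s * b) ` A" by (simp add: Y_def image_image cc)
  have fibre: "card {y \<in> Y. cell m b y = c} \<le> b ^ m - h ^ m" for c
  proof -
    define F where "F = {y \<in> Y. cell m b y = c}"
    define rem where "rem y = (\<lambda>i\<in>{1..m}. y i mod b)" for y :: "nat \<Rightarrow> nat"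
    have Yi: "y \<in> {1..m} \<rightarrow>\<^sub>E UNIV" if "y \<in> Y" for y
      using that by (auto simp: Y_def cell_def)
    have recon: "y i = b * c i + rem y i" if "y \<in> F" "i \<in> {1..m}" for y i
      using that by (auto simp: F_def cell_def rem_def)
    have "inj_on rem F"
    proof (rule inj_onI)
      fix y y' assume y: "y \<in> F" "y' \<in> F" "rem y = rem y'"
      have "y \<in> Y" "y' \<in> Y" using y by (simp_all add: F_def)
      then show "y = y'"
      proof (rule PiE_ext[OF Yi Yi])
        fix i assume i: "i \<in> {1..m}"
        show "y i = y' i" using recon[OF y(1) i] recon[OF y(2) i] y(3) by metis
      qed
    qed
    moreover have "card (rem ` F) + h ^ m \<le> (k * h) ^ m"
    proof (rule card_pattern_free[OF _ h1])
      show "rem ` F \<subseteq> {1..m} \<rightarrow>\<^sub>E {0..<k * h}"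
        using b0 by (auto simp: rem_def b_def)
      fix u :: "nat \<Rightarrow> nat" assume u: "u \<in> {1..m} \<rightarrow>\<^sub>E {0..<h}"
      define a where "a i = real (s * (b * c i + u i))" for i
      have "real m * (real s - 1) < real m * real s" using m by simp
      also have "\<dots> \<le> \<epsilon> * real h * real s" using h by (intro mult_right_mono) auto
      also have "\<dots> = \<epsilon> * real (s * h)" by simp
      finally have small: "real m * (real s - 1) < \<epsilon> * real (s * h)" .
      have "real (s * h) > 0" using s h1 by simp
      from cube_free_misses_vertex[OF A this small, of a] obtain v where v: "v \<in> cube_index m k"
        and far: "\<And>x. x \<in> A \<Longrightarrow> \<exists>i\<in>{1..m}. \<not> \<bar>real (x i) - (a i + real (s * h) * real (v i))\<bar> \<le> real s - 1"
        by blast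
      have "(\<lambda>i\<in>{1..m}. u i + h * v i) \<notin> rem ` F"
      proof
        assume "(\<lambda>i\<in>{1..m}. u i + h * v i) \<in> rem ` F"
        then obtain y where y: "y \<in> F" "(\<lambda>i\<in>{1..m}. u i + h * v i) = rem y" by auto
        then obtain x where x: "x \<in> A" "y = cell m s x" by (auto simp: F_def Y_def)
        obtain i where i: "i \<in> {1..m}"
          and not: "\<not> \<bar>real (x i) - (a i + real (s * h) * real (v i))\<bar> \<le> real s - 1"
          using far[OF x(1)] by blast
        have "rem y i = u i + h * v i" using y(2) i by (metis restrict_apply')
        then have "x i div s = b * c i + u i + h * v i"
          using recon[OF y(1) i] x(2) i by (simp add: cell_def)
        then have "x i = s * (b * c i + u i + h * v i) + x i mod s"
          by (metis mult_div_mod_eq)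
        then have "real (x i) = real (s * (b * c i + u i + h * v i)) + real (x i mod s)"
          by (metis of_nat_add)
        then have "real (x i) - (a i + real (s * h) * real (v i)) = real (x i mod s)"
          by (simp add: a_def algebra_simps)
        moreover have "x i mod s < s" using s by simp
        then have "real (x i mod s) \<le> real s - 1" by linarith
        ultimately show False using not by simp
      qed
      then show "\<exists>v\<in>cube_index m k. (\<lambda>i\<in>{1..m}. u i + h * v i) \<notin> rem ` F" using v by blast
    qed
    ultimately have "card F + h ^ m \<le> b ^ m" by (simp add: card_image b_def)
    then show ?thesis unfolding F_def by linarith
  qed
  have "card Y = (\<Sum>c\<in>cell m b ` Y. card {y \<in> Y. cell m b y = c})"
    using sum.image_gen[OF finY, of "\<lambda>_. 1::nat" "cell m b"] by simp
  also have "\<dots> \<le> (\<Sum>c\<in>cell m b ` Y. b ^ m - h ^ m)" by (intro sum_mono fibre)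
  also have "\<dots> = (b ^ m - h ^ m) * card (cell m (s * b) ` A)" by (simp add: img)
  finally show ?thesis unfolding Y_def b_def .
qed

lemma card_le_iterated_cells:
  assumes A: "cube_free \<epsilon> N m k A" and m: "m \<ge> 1" and k: "k \<ge> 1" and \<epsilon>: "\<epsilon> > 0"
    and h: "real m \<le> \<epsilon> * real h"
  shows "card A \<le> ((k * h) ^ m - h ^ m) ^ t * (N div (k * h) ^ t + 1) ^ m"
proof -
  have "0 < \<epsilon> * real h" using h m by linarith
  then have h1: "h \<ge> 1" using \<epsilon> by (simp add: zero_less_mult_iff)
  have AG: "A \<subseteq> grid N m" using A by (simp add: cube_free_def)
  have "cell m 1 x = x" if "x \<in> A" for x
  proof -
    have "x \<in> extensional {1..m}" using that AG by (auto simp: grid_def PiE_def)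
    then show ?thesis by (simp add: cell_def extensional_restrict)
  qed
  then have "cell m 1 ` A = A" by simp
  then have "card A = card (cell m ((k * h) ^ 0) ` A)" by simp
  also have "\<dots> \<le> ((k * h) ^ m - h ^ m) ^ t * card (cell m ((k * h) ^ t) ` A)"
  proof (induction t)
    case (Suc t)
    have "card (cell m ((k * h) ^ t) ` A) \<le> ((k * h) ^ m - h ^ m) * card (cell m ((k * h) ^ t * (k * h)) ` A)"
      using k h1 by (intro card_cells_step[OF A m k _ \<epsilon> h]) simp
    then have "((k * h) ^ m - h ^ m) ^ t * card (cell m ((k * h) ^ t) ` A)
       \<le> ((k * h) ^ m - h ^ m) ^ t * (((k * h) ^ m - h ^ m) * card (cell m ((k * h) ^ t * (k * h)) ` A))"
      by (rule mult_le_mono2)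
    with Suc show ?case by (simp only: power_Suc2 mult.assoc)
  qed simp
  also have "card (cell m ((k * h) ^ t) ` A) \<le> (N div (k * h) ^ t + 1) ^ m"
  proof -
    have "cell m ((k * h) ^ t) ` A \<subseteq> {1..m} \<rightarrow>\<^sub>E {0..<N div (k * h) ^ t + 1}"
    proof
      fix y assume "y \<in> cell m ((k * h) ^ t) ` A"
      then obtain x where x: "x \<in> grid N m" "y = cell m ((k * h) ^ t) x" using AG by auto
      have "x i \<le> N" if "i \<in> {1..m}" for i using x(1) that by (auto simp: grid_def)
      then show "y \<in> {1..m} \<rightarrow>\<^sub>E {0..<N div (k * h) ^ t + 1}"
        unfolding x(2) cell_def by (auto simp: less_Suc_eq_le intro!: div_le_mono)
    qed
    then have "card (cell m ((k * h) ^ t) ` A) \<le> card ({1..m} \<rightarrow>\<^sub>E {0..<N div (k * h) ^ t + 1})"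
      by (intro card_mono finite_PiE) auto
    then show ?thesis by (simp add: card_PiE)
  qed
  finally show ?thesis by simp
qed

text \<open>
  The box \<open>[k h]^m\<close> with \<open>h = N div k\<close> is a disjoint union of \<open>h^m\<close> exact cubes with side \<open>h\<close>,
  and \<open>A\<close> misses a point of each. This serves the \<open>N\<close> with few scales.
\<close>

lemma card_le_missing_exact_cubes:
  assumes A: "cube_free \<epsilon> N m k A" and \<epsilon>: "\<epsilon> > 0" and k: "k \<ge> 1" "k \<le> N"
  shows "card A + (N div k) ^ m \<le> N ^ m"
proof -
  define h where "h = N div k"
  have h1: "h \<ge> 1" using k by (simp add: h_def div_greater_zero_iff Suc_le_eq)
  have kh: "k * h \<le> N" by (simp add: h_def)
  have AG: "A \<subseteq> grid N m" using A by (simp add: cube_free_def)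
  then have finA: "finite A" using finite_grid finite_subset by blast
  define G where "G = grid (k * h) m"
  have GN: "G \<subseteq> grid N m" unfolding G_def grid_def using kh by (intro PiE_mono) auto
  \<comment> \<open>The coordinates of the grid start at 1, those of the box at 0.\<close>
  define shift where "shift x = (\<lambda>i\<in>{1..m}. x i - 1)" for x :: "nat \<Rightarrow> nat"
  have inj: "inj_on shift (A \<inter> G)"
  proof (rule inj_onI)
    fix x y assume xy: "x \<in> A \<inter> G" "y \<in> A \<inter> G" "shift x = shift y"
    then have G: "x \<in> {1..m} \<rightarrow>\<^sub>E {1..k * h}" "y \<in> {1..m} \<rightarrow>\<^sub>E {1..k * h}"
      by (auto simp: G_def grid_def)
    show "x = y"
    proof (rule PiE_ext[OF G])
      fix i assume i: "i \<in> {1..m}"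
      have "x i \<in> {1..k * h}" "y i \<in> {1..k * h}" using G i by blast+
      moreover have "x i - 1 = y i - 1" using xy(3) i by (metis shift_def restrict_apply')
      ultimately show "x i = y i" by (simp only: atLeastAtMost_iff) linarith
    qed
  qed
  have "card (shift ` (A \<inter> G)) + h ^ m \<le> (k * h) ^ m"
  proof (rule card_pattern_free[OF _ h1])
    show "shift ` (A \<inter> G) \<subseteq> {1..m} \<rightarrow>\<^sub>E {0..<k * h}"
    proof
      fix y assume "y \<in> shift ` (A \<inter> G)"
      then obtain x where x: "x \<in> {1..m} \<rightarrow>\<^sub>E {1..k * h}" "y = shift x"
        by (auto simp: G_def grid_def)
      have "x i - 1 < k * h" if "i \<in> {1..m}" for i using PiE_mem[OF x(1) that] by auto
      then show "y \<in> {1..m} \<rightarrow>\<^sub>E {0..<k * h}" unfolding x(2) shift_def by auto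
    qed
    fix u :: "nat \<Rightarrow> nat" assume "u \<in> {1..m} \<rightarrow>\<^sub>E {0..<h}"
    have "real h > 0" "real m * 0 < \<epsilon> * real h" using h1 \<epsilon> by auto
    from cube_free_misses_vertex[OF A this, of "\<lambda>i. real (u i + 1)"] obtain v
      where v: "v \<in> cube_index m k"
        and far: "\<And>x. x \<in> A \<Longrightarrow> \<exists>i\<in>{1..m}. real (x i) \<noteq> real (u i + 1) + real h * real (v i)"
      by fastforce
    have "(\<lambda>i\<in>{1..m}. u i + h * v i) \<notin> shift ` (A \<inter> G)"
    proof
      assume "(\<lambda>i\<in>{1..m}. u i + h * v i) \<in> shift ` (A \<inter> G)"
      then obtain x where x: "x \<in> A \<inter> G" "(\<lambda>i\<in>{1..m}. u i + h * v i) = shift x" by auto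
      have "x i = u i + 1 + h * v i" if i: "i \<in> {1..m}" for i
      proof -
        have "x i \<in> {1..k * h}" using x(1) i by (auto simp: G_def grid_def)
        moreover have "u i + h * v i = x i - 1"
          using fun_cong[OF x(2), of i] i by (simp add: shift_def)
        ultimately show ?thesis by (simp only: atLeastAtMost_iff) linarith
      qed
      then have "real (x i) = real (u i + 1) + real h * real (v i)" if "i \<in> {1..m}" for i
        using that by simp
      then show False using far[of x] x(1) by blast
    qed
    then show "\<exists>v\<in>cube_index m k. (\<lambda>i\<in>{1..m}. u i + h * v i) \<notin> shift ` (A \<inter> G)"
      using v by blast
  qed
  then have 1: "card (A \<inter> G) + h ^ m \<le> (k * h) ^ m" using inj by (simp add: card_image)
  have "card (A - G) \<le> card (grid N m - G)"
    using AG by (intro card_mono) (auto simp: finite_grid)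
  also have "\<dots> = N ^ m - (k * h) ^ m"
    using GN by (simp add: card_Diff_subset finite_grid G_def card_grid)
  finally have 2: "card (A - G) \<le> N ^ m - (k * h) ^ m" .
  have "(k * h) ^ m \<le> N ^ m" using kh by (rule power_mono) simp
  moreover have "card A = card (A \<inter> G) + card (A - G)"
    using finA by (metis card_Int_Diff add.commute)
  ultimately show ?thesis using 1 2 unfolding h_def by linarith
qed

text \<open>
  The base \<open>b = k h\<close> satisfies \<open>ln b \<le> C \<Lambda>\<close>. With \<open>t\<close> scales, rounding at the top level costs a factor
  \<open>2^m\<close>, and \<open>t \<ge> T\<close> makes half of the gain \<open>exp (- t/k^m)\<close> sufficient to pay for it. When
  \<open>t < T\<close>, \<open>ln N \<le> T C \<Lambda>\<close>, and \<open>c\<close> is chosen so small that the claimed factor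
  \<open>exp (- c ln N / \<Lambda>)\<close> is at least the factor \<open>1 - (2 k)^-m\<close> coming from exact cubes.
\<close>

lemma upper_bound:
  assumes k: "k \<ge> 2" and m: "m \<ge> 1"
  defines "C \<equiv> 1 + ln (2 * real k * real m)"
  defines "T \<equiv> 2 * m * k ^ m"
  defines "c \<equiv> 1 / (4 * C * real T * (2 * real k) ^ m)"
  assumes \<epsilon>: "0 < \<epsilon>" "\<epsilon> < 1/125" and N: "N \<ge> k"
  shows "real (max_cube_free \<epsilon> N m k) \<le> real N powr (real m - c * ln (1/\<epsilon>) powr (- 1))"
proof -
  define \<Lambda> where "\<Lambda> = ln (1/\<epsilon>)"
  have e\<Lambda>: "exp \<Lambda> = 1 / \<epsilon>" using \<epsilon> by (simp add: \<Lambda>_def)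
  have "exp 1 \<le> (3::real)" using exp_le by simp
  also have "(3::real) \<le> 1 / \<epsilon>" using \<epsilon> by (simp add: field_simps)
  finally have \<Lambda>1: "1 \<le> \<Lambda>" unfolding e\<Lambda>[symmetric] by simp
  define \<kappa> where "\<kappa> = 1 / real k ^ m"
  have \<kappa>: "0 < \<kappa>" using k by (simp add: \<kappa>_def)
  have km: "1 \<le> real k * real m" using k m by (metis le_trans mult_le_mono nat_mult_1 of_nat_1 of_nat_le_iff of_nat_mult one_le_numeral)
  then have lnkm: "0 \<le> ln (2 * real k * real m)" by simp
  then have C: "1 \<le> C" by (simp add: C_def)
  have T: "2 \<le> T" using k m unfolding T_def
    by (metis One_nat_def Suc_leI le_trans mult_le_mono mult_2_right mult_le_mono2 nat_mult_1_right one_le_power le_numeral_extra(4) one_le_numeral mult.assoc)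
  have N1: "1 < real N" using N k by simp
  define n0 where "n0 = ln (real N)"
  have n0: "0 < n0" "exp n0 = real N" using N1 by (auto simp: n0_def)
  have c0: "0 < c" using C T k by (simp add: c_def)
  obtain A where A: "cube_free \<epsilon> N m k A" and cA: "card A = max_cube_free \<epsilon> N m k"
    using obtain_extremal_set k by (metis One_nat_def Suc_leD numeral_2_eq_2)
  define h where "h = nat \<lceil>real m / \<epsilon>\<rceil>"
  have me: "1 \<le> real m / \<epsilon>" using m \<epsilon> by (simp add: field_simps) 
  have h: "real m / \<epsilon> \<le> real h" "real h \<le> 2 * (real m / \<epsilon>)" using me unfolding h_def by linarith+
  then have h2: "real m \<le> \<epsilon> * real h" using \<epsilon> by (simp add: field_simps)
  have h1: "h \<ge> 1" using h me by linarith
  define b where "b = real (k * h)"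
  have "2 * 1 \<le> k * h" by (rule mult_le_mono[OF k h1])
  then have "real (2 * 1) \<le> b" unfolding b_def by (simp only: of_nat_le_iff)
  then have b1: "2 \<le> b" by simp
  have "b \<le> real k * (2 * (real m / \<epsilon>))" unfolding b_def of_nat_mult using h by (intro mult_left_mono) auto
  also have "\<dots> = (2 * real k * real m) * exp \<Lambda>" by (simp add: e\<Lambda>)
  finally have "ln b \<le> ln ((2 * real k * real m) * exp \<Lambda>)" using b1 by (intro ln_mono) auto
  also have "\<dots> = ln (2 * real k * real m) + \<Lambda>" using km by (subst ln_mult) auto
  also have "\<dots> \<le> ln (2 * real k * real m) * \<Lambda> + \<Lambda>"
    using mult_left_mono[OF \<Lambda>1 lnkm] by simp
  finally have lnb: "ln b \<le> C * \<Lambda>" by (simp add: C_def algebra_simps)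
  have lb0: "0 < ln b" using b1 by simp
  have key: ?thesis if "real (card A) \<le> exp (real m * n0 - c * n0 / \<Lambda>)"
  proof -
    have "real N powr (real m - c * \<Lambda> powr (- 1)) = exp (real m * n0 - c * n0 / \<Lambda>)"
      using N1 \<Lambda>1 by (simp add: powr_def[of "real N"] n0_def powr_minus field_simps)
    then show ?thesis using that cA by (simp add: \<Lambda>_def)
  qed
  have Nm: "real N ^ m = exp (real m * n0)" by (simp add: n0(2) exp_of_nat_mult)
  define t where "t = nat \<lfloor>n0 / ln b\<rfloor>"
  have "real t = of_int \<lfloor>n0 / ln b\<rfloor>" using n0 lb0 by (simp add: t_def)
  then have "real t \<le> n0 / ln b" "n0 / ln b \<le> real t + 1" by linarith+
  then have t: "real t * ln b \<le> n0" "n0 \<le> (real t + 1) * ln b"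
    using lb0 by (auto simp: field_simps)
  show ?thesis
  proof (cases "t < T")
    case True
    have "n0 \<le> real T * ln b"
    proof -
      have "(real t + 1) * ln b \<le> real T * ln b" using True lb0 by (intro mult_right_mono) auto
      then show ?thesis using t by linarith
    qed
    also have "\<dots> \<le> real T * (C * \<Lambda>)" using lnb by (intro mult_left_mono) auto
    finally have "c * n0 \<le> c * (real T * (C * \<Lambda>))" using c0 by (intro mult_left_mono) auto
    also have "\<dots> = \<Lambda> * (1 / (4 * (2 * real k) ^ m))" using C T k by (simp add: c_def)
    finally have "c * n0 / \<Lambda> \<le> 1 / (4 * (2 * real k) ^ m)" using \<Lambda>1 by (simp add: field_simps)
    also have "\<dots> \<le> 1 / (2 * real k) ^ m" using k by (simp add: field_simps)
    finally have c1: "c * n0 / \<Lambda> \<le> 1 / (2 * real k) ^ m" .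
    have "real N / (2 * real k) \<le> real (N div k)"
    proof -
      have "N = k * (N div k) + N mod k" by simp
      moreover have "N mod k < k" using k by simp
      moreover have "1 \<le> N div k" using N k by (simp add: div_greater_zero_iff Suc_le_eq)
      then have "k * 1 \<le> k * (N div k)" by (rule mult_le_mono2)
      ultimately have "N \<le> 2 * k * (N div k)" by linarith
      then have "real N \<le> real (2 * k * (N div k))" by (simp only: of_nat_le_iff)
      then have "real N \<le> 2 * real k * real (N div k)" by simp
      then show ?thesis using k by (simp add: field_simps)
    qed
    then have "(real N / (2 * real k)) ^ m \<le> real (N div k) ^ m" by (intro power_mono) auto
    moreover have "real (card A) + real (N div k) ^ m \<le> real N ^ m"
      using card_le_missing_exact_cubes[OF A \<epsilon>(1) _ N] k
      by (metis One_nat_def Suc_leD numeral_2_eq_2 of_nat_add of_nat_le_iff of_nat_power)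
    ultimately have "real (card A) \<le> real N ^ m * (1 - 1 / (2 * real k) ^ m)"
      by (simp add: power_divide algebra_simps)
    also have "\<dots> \<le> real N ^ m * exp (- (1 / (2 * real k) ^ m))"
      using exp_ge_add_one_self[of "- (1 / (2 * real k) ^ m)"] by (intro mult_left_mono) auto
    also have "\<dots> \<le> real N ^ m * exp (- (c * n0 / \<Lambda>))"
      using c1 by (intro mult_left_mono) auto
    also have "\<dots> = exp (real m * n0 - c * n0 / \<Lambda>)" unfolding Nm by (simp flip: exp_add)
    finally show ?thesis by (rule key)
  next
    case False
    have bt: "b ^ t \<le> real N"
    proof -
      have "b ^ t = exp (ln b) ^ t" using b1 by simp
      also have "\<dots> = exp (real t * ln b)" by (simp only: exp_of_nat_mult)
      also have "\<dots> \<le> exp n0" using t by simp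
      finally show ?thesis by (simp add: n0)
    qed
    have bt0: "0 < b ^ t" using b1 by simp
    have cells: "real (N div (k * h) ^ t + 1) \<le> 2 * real N / b ^ t"
    proof -
      have "real (N div (k * h) ^ t) \<le> real N / b ^ t"
        unfolding b_def using of_nat_div_le_of_nat[of N "(k * h) ^ t", where 'a = real] by simp
      moreover have "1 \<le> real N / b ^ t" using bt bt0 by (simp add: field_simps)
      ultimately show ?thesis by simp
    qed
    have dens: "real ((k * h) ^ m - h ^ m) \<le> b ^ m * exp (- \<kappa>)"
    proof -
      have "h ^ m \<le> (k * h) ^ m" using k by (intro power_mono) auto
      then have "real ((k * h) ^ m - h ^ m) = b ^ m - real h ^ m" by (simp add: of_nat_diff b_def)
      also have "\<dots> = b ^ m * (1 - \<kappa>)" using k by (simp add: b_def \<kappa>_def power_mult_distrib field_simps)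
      also have "\<dots> \<le> b ^ m * exp (- \<kappa>)"
        using exp_ge_add_one_self[of "- \<kappa>"] b1 by (intro mult_left_mono) auto
      finally show ?thesis .
    qed
    have "real (card A) \<le> real (((k * h) ^ m - h ^ m) ^ t * (N div (k * h) ^ t + 1) ^ m)"
      using card_le_iterated_cells[OF A m _ \<epsilon>(1) h2] k by (simp only: of_nat_le_iff)
    also have "\<dots> = real ((k * h) ^ m - h ^ m) ^ t * real (N div (k * h) ^ t + 1) ^ m"
      by (simp only: of_nat_mult of_nat_power)
    also have "\<dots> \<le> (b ^ m * exp (- \<kappa>)) ^ t * (2 * real N / b ^ t) ^ m"
      using dens cells b1 by (intro mult_mono power_mono) auto
    also have "\<dots> = exp (- \<kappa>) ^ t * 2 ^ m * real N ^ m"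
      using bt0 b1 by (simp add: power_mult_distrib power_divide flip: power_mult) (simp add: mult.commute)
    also have "\<dots> = exp (real m * n0 + real m * ln 2 - \<kappa> * real t)"
    proof -
      have "exp (- \<kappa>) ^ t = exp (- (\<kappa> * real t))" by (simp add: mult.commute flip: exp_of_nat_mult)
      moreover have "(2::real) ^ m = exp (real m * ln 2)" by (simp add: exp_of_nat_mult)
      ultimately show ?thesis unfolding Nm by (simp flip: exp_add)
    qed
    also have "\<dots> \<le> exp (real m * n0 - c * n0 / \<Lambda>)"
    proof -
      have "2 * real m = \<kappa> * real T" using k by (simp add: T_def \<kappa>_def)
      also have "\<dots> \<le> \<kappa> * real t" using False \<kappa> by (intro mult_left_mono) auto
      finally have 1: "real m \<le> \<kappa> * real t / 2" by simp
      have "ln (2::real) \<le> 1" using ln_le_minus_one[of 2] by simp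
      then have 2: "real m * ln 2 \<le> real m * 1" by (intro mult_left_mono) auto
      have "(real t + 1) * ln b \<le> (2 * real t) * (C * \<Lambda>)"
        using False T lnb lb0 by (intro mult_mono) auto
      then have "c * n0 \<le> c * (2 * real t * (C * \<Lambda>))" using t c0 by (intro mult_left_mono) auto
      then have "c * n0 / \<Lambda> \<le> (2 * c * C) * real t" using \<Lambda>1 by (simp add: field_simps)
      also have "\<dots> \<le> (\<kappa> / 2) * real t"
      proof (rule mult_right_mono)
        have "real k ^ m \<le> (2 * real k) ^ m" by (intro power_mono) auto
        also have "\<dots> = 1 * (2 * real k) ^ m" by simp
        also have "\<dots> \<le> real T * (2 * real k) ^ m" using T k by (intro mult_right_mono) auto
        finally have "1 / (real T * (2 * real k) ^ m) \<le> \<kappa>"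
          unfolding \<kappa>_def using k T by (intro divide_left_mono mult_pos_pos zero_less_power) auto
        moreover have "2 * c * C = 1 / (real T * (2 * real k) ^ m) / 2"
          using C by (simp add: c_def)
        ultimately show "2 * c * C \<le> \<kappa> / 2" by simp
      qed simp
      finally show ?thesis using 1 2 by simp
    qed
    finally show ?thesis by (rule key)
  qed
qed

text \<open>
  With \<open>\<ell> = q + 1\<close>, the number of doublings of the degree that \<open>k\<close> permits in Rankin's construction is
  \<open>\<ell> - 1\<close>.
\<close>

lemma two_powr_ceiling_log_less:
  fixes k :: nat
  assumes "k \<ge> 3"
  obtains q where "2 ^ q < k" "real_of_int \<lceil>log 2 (real k)\<rceil> = real q + 1"
proof -
  have "0 < log 2 (real k)" using assms by simp
  then have pos: "1 \<le> \<lceil>log 2 (real k)\<rceil>" by linarith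
  define q where "q = nat (\<lceil>log 2 (real k)\<rceil> - 1)"
  have q: "real_of_int \<lceil>log 2 (real k)\<rceil> = real q + 1" using pos by (simp add: q_def)
  then have "real q < log 2 (real k)" by linarith
  then have "2 powr real q < real k" using assms by (subst (asm) less_log_iff) auto
  then have "real (2 ^ q) < real k" by (simp add: powr_realpow)
  then have "2 ^ q < k" by (simp only: of_nat_less_iff)
  from that[OF this q] show thesis .
qed

theorem theorem1p7:
  "\<exists>(N0 :: nat \<Rightarrow> real \<Rightarrow> nat) (c1 :: nat \<Rightarrow> nat \<Rightarrow> real) (c2 :: nat \<Rightarrow> nat \<Rightarrow> real).
     \<forall>(m::nat) (k::nat). m \<ge> 1 \<and> k \<ge> 3 \<longrightarrow>
       c1 k m > 0 \<and> c2 k m > 0 \<and>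
       (\<forall>\<epsilon>::real. 0 < \<epsilon> \<and> \<epsilon> < 1/125 \<longrightarrow>
         (\<forall>N::nat. N \<ge> N0 k \<epsilon> \<longrightarrow>
           (let l = real_of_int \<lceil>log 2 (real k)\<rceil> in
             real N powr (real m - c1 k m * ln (1/\<epsilon>) powr (1/l - 1))
               \<le> real (max_cube_free \<epsilon> N m k) \<and>
             real (max_cube_free \<epsilon> N m k)
               \<le> real N powr (real m - c2 k m * ln (1/\<epsilon>) powr (-1)))))"
proof -
  define l where "l k = real_of_int \<lceil>log 2 (real k)\<rceil>" for k :: nat
  have "\<exists>c>0. \<forall>\<epsilon> N m. 0 < \<epsilon> \<longrightarrow> \<epsilon> < 1/125 \<longrightarrow> real N \<ge> exp ((ln (1/\<epsilon>))\<^sup>2) \<longrightarrow> m \<ge> 1 \<longrightarrow>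
          real N powr (real m - c * ln (1/\<epsilon>) powr (1 / l k - 1)) \<le> real (max_cube_free \<epsilon> N m k)"
    if k: "k \<ge> 3" for k
  proof -
    obtain q where "2 ^ q < k" "l k = real q + 1"
      using two_powr_ceiling_log_less[OF k] unfolding l_def by blast
    then show ?thesis using lower_bound[of q k] k by simp
  qed
  then obtain c1 where c1: "\<And>k. k \<ge> 3 \<Longrightarrow> c1 k > 0"
    "\<And>k \<epsilon> N m. \<lbrakk>k \<ge> 3; 0 < \<epsilon>; \<epsilon> < 1/125; real N \<ge> exp ((ln (1/\<epsilon>))\<^sup>2); m \<ge> 1\<rbrakk> \<Longrightarrow>
        real N powr (real m - c1 k * ln (1/\<epsilon>) powr (1 / l k - 1)) \<le> real (max_cube_free \<epsilon> N m k)"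
    by metis
  define c2 where "c2 k m = 1 / (4 * (1 + ln (2 * real k * real m)) * real (2 * m * k ^ m) * (2 * real k) ^ m)"
    for k m :: nat
  define N0 where "N0 k \<epsilon> = max k (nat \<lceil>exp ((ln (1/\<epsilon>))\<^sup>2)\<rceil>)" for k :: nat and \<epsilon> :: real
  have c2_pos: "c2 k m > 0" if "m \<ge> 1" "k \<ge> 3" for k m
  proof -
    have "1 \<le> k * m" using that by (metis One_nat_def Suc_leI le_trans mult_le_mono nat_mult_1 one_le_numeral)
    then have "1 \<le> real k * real m" by (metis of_nat_1 of_nat_le_iff of_nat_mult)
    then have "0 \<le> ln (2 * real k * real m)" by simp
    then show ?thesis using that unfolding c2_def
      by (intro divide_pos_pos mult_pos_pos add_pos_nonneg zero_less_power) auto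
  qed
  show ?thesis
  proof (rule exI[of _ N0], rule exI[of _ "\<lambda>k m. c1 k"], rule exI[of _ c2], intro allI impI conjI)
    fix m k :: nat assume mk: "m \<ge> 1 \<and> k \<ge> 3"
    show "c1 k > 0" "c2 k m > 0" using mk c1(1) c2_pos by auto
    fix \<epsilon> :: real and N :: nat
    assume \<epsilon>: "0 < \<epsilon> \<and> \<epsilon> < 1/125" and N: "N0 k \<epsilon> \<le> N"
    have "N \<ge> k" "real N \<ge> exp ((ln (1/\<epsilon>))\<^sup>2)" using N unfolding N0_def by linarith+
    then have "real N powr (real m - c1 k * ln (1/\<epsilon>) powr (1 / l k - 1)) \<le> real (max_cube_free \<epsilon> N m k)"
      "real (max_cube_free \<epsilon> N m k) \<le> real N powr (real m - c2 k m * ln (1/\<epsilon>) powr (-1))"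
      using mk \<epsilon> c1(2) upper_bound[of k m \<epsilon> N] unfolding c2_def by auto
    then show "let l = real_of_int \<lceil>log 2 (real k)\<rceil> in
        real N powr (real m - c1 k * ln (1/\<epsilon>) powr (1/l - 1)) \<le> real (max_cube_free \<epsilon> N m k) \<and>
        real (max_cube_free \<epsilon> N m k) \<le> real N powr (real m - c2 k m * ln (1/\<epsilon>) powr (-1))"
      by (simp add: l_def)
  qed
qed

end
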